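(* Let $k \ge 2$ be an integer, let $\alpha_1, \ldots, \alpha_{k-1}, \gamma_1, \ldots, \gamma_{k-1} \in \mathbb{R}$, and assume that the multiplicative exponent of $\boldsymbol{\alpha} = (\alpha_1, \ldots, \alpha_{k-1})$ satisfies $\omega^\times(\boldsymbol{\alpha}) < \frac{k-1}{k-2}$ (for $k=2$ this condition reads $\omega^\times(\boldsymbol{\alpha}) < \infty$). Let $\psi: \mathbb{N} \to \mathbb{R}_{\ge 0}$ be a decreasing function such that \[ \sum_{n=1}^\infty \psi(n) (\log n)^{k-1} = \infty. \] Then for almost all $\alpha \in \mathbb{R}$ (with respect to Lebesgue measure) there exist infinitely many $n \in \mathbb{N}$ such that \[ \| n \alpha_1 - \gamma_1 \| \cdots \| n \alpha_{k-1} - \gamma_{k-1} \| \cdot \| n \alpha \| < \psi(n). \]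
   Context: $\mathbb{N}$ denotes the positive integers. For $x \in \mathbb{R}$, $\|x\|$ denotes the distance from $x$ to the nearest integer. The multiplicative exponent $\omega^\times(\boldsymbol{\alpha})$ of $\boldsymbol{\alpha} = (\alpha_1, \ldots, \alpha_{k-1}) \in \mathbb{R}^{k-1}$ is the supremum (possibly $+\infty$) of the set of real numbers $w$ such that, for infinitely many $n \in \mathbb{N}$, \[ \| n \alpha_1 \| \cdots \| n \alpha_{k-1} \| < n^{-w}. \] "Decreasing" means $\psi(n) \ge \psi(n+1)$ for all $n \in \mathbb{N}$. *)

theory Defs
  imports "HOL-Analysis.Analysis"
begin

definition dist_int :: "real \<Rightarrow> real" where
  "dist_int x = infdist x \<int>"

text \<open>Only the coordinates \<open>\<alpha> 1, \<dots>, \<alpha> d\<close> of \<open>\<alpha>\<close> matter. The supremum is taken in the extended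
  reals, so the exponent is \<open>\<infinity>\<close> when the admissible \<open>w\<close> are unbounded.\<close>

definition mult_exponent :: "nat \<Rightarrow> (nat \<Rightarrow> real) \<Rightarrow> ereal" where
  "mult_exponent d \<alpha> =
    (SUP w \<in> {w :: real. infinite {n :: nat. n \<ge> 1 \<and>
        (\<Prod>i=1..d. dist_int (real n * \<alpha> i)) < real n powr (-w)}}. ereal w)"

end

theory Submission
  imports Defs "HOL-Number_Theory.Totient" "HOL-Real_Asymp.Real_Asymp"
begin

text \<open>
  Write \<open>d = k - 1\<close> and \<open>P n\<close> for the product of the \<open>d\<close> distances
  \<open>dist_int (n * \<alpha> i - \<gamma> i)\<close>. The task is to show that almost every \<open>a\<close> satisfies
  \<open>dist_int (n * a) < \<psi> n / P n\<close> infinitely often. This is a one-dimensional problem with a very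
  irregular approximation function, and three things have to be supplied: the size of
  \<open>1 / P n\<close> on average, a divergence Borel--Cantelli argument, and a zero--one law.

  The size of \<open>1 / P n\<close>. The sum of the first \<open>J\<close> Fejer kernels of orders \<open>2, 4, \<dots>, 2 ^ J\<close> is a
  trigonometric polynomial of degree below \<open>2 ^ J\<close> with mean \<open>J\<close> which is at most \<open>3 / dist_int x\<close> at each
  noninteger \<open>x\<close>. Hence the product \<open>W n\<close> of its values at the points \<open>n * \<alpha> i - \<gamma> i\<close> is at most
  \<open>3 ^ d / P n\<close>, and expanding it into exponentials shows that its average over a block
  \<open>2 ^ t < n \<le> 2 ^ (t + 1)\<close> is close to \<open>J ^ d\<close>, provided that no linear form \<open>h \<bullet> \<alpha>\<close> with
  nonzero integer coefficients of size at most \<open>2 ^ J\<close> is too close to an integer. When \<open>J\<close> is a small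
  constant times \<open>t\<close>, a polynomial lower bound for the linear forms suffices, and \<open>J ^ d\<close> still has
  the order of \<open>ln n ^ d\<close>. The polynomial lower bound is where the exponent enters
  (\<open>linear_form_lower_bound\<close>): if a form \<open>h \<bullet> \<alpha>\<close> is extremely close to an integer, then Dirichlet's theorem
  for \<open>d - 1\<close> of the coordinates gives a simultaneous approximation that is good in all \<open>d\<close>
  coordinates, with product about \<open>n powr (- d / (d - 1))\<close>; for \<open>d = 1\<close> the form itself is the approximation.

  Borel--Cantelli. For the intervals of radius \<open>\<Psi> n / n\<close> around the reduced fractions with
  denominator \<open>n\<close>, distinct fractions contribute at most \<open>8 * \<Psi> m * \<Psi> n\<close> to the overlaps
  (\<open>sum_measure_overlap_le\<close>), so a second moment computation gives a limsup set of positive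
  measure as soon as the sum of \<open>\<Psi> n * totient n / n\<close> is comparable to the divergent sum of \<open>\<Psi> n\<close>
  (\<open>limsup_reduced_intervals_not_null\<close>). For \<open>\<Psi>\<close> proportional to \<open>W\<close> on each block the comparison
  holds because the average of \<open>W\<close> over multiples of \<open>q\<close> is also close to \<open>J ^ d\<close> for \<open>q \<le> 2 ^ J\<close>,
  and the sum of \<open>1 / q\<^sup>2\<close> over \<open>q \<ge> 2\<close> is at most \<open>3 / 4\<close>
  (\<open>bohr_weight_block_estimates\<close>).

  Zero--one law. The set of \<open>a\<close> with \<open>dist_int (n * a) < C * \<Psi> n\<close> infinitely often for some constant
  \<open>C\<close> is mapped into itself by \<open>a \<mapsto> 2 * a\<close> and by integer translations, hence is null or has full
  measure. To absorb the constant \<open>C\<close>, the function \<open>\<Psi>\<close> is chosen smaller than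
  \<open>\<psi> n / P n\<close> by a factor that tends to infinity; by the Abel--Dini theorem this can be
  done without losing the divergence.
\<close>

section \<open>Distance to the nearest integer and exponential sums\<close>

lemma dist_int_nonneg [simp]: "dist_int x \<ge> 0"
  by (simp add: dist_int_def infdist_nonneg)

lemma dist_int_le_abs_diff: "dist_int x \<le> \<bar>x - of_int z\<bar>"
  unfolding dist_int_def by (rule infdist_le2[of "of_int z"]) (auto simp: dist_real_def)

lemma dist_int_attained: "\<exists>z::int. dist_int x = \<bar>x - of_int z\<bar>"
proof -
  have "dist_int x = \<bar>x - of_int (round x)\<bar>"
  proof (rule antisym)
    show "dist_int x \<le> \<bar>x - of_int (round x)\<bar>" by (rule dist_int_le_abs_diff)
    have "\<bar>x - of_int (round x)\<bar> \<le> dist x a" if a: "a \<in> \<int>" for a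
    proof -
      obtain m where "a = of_int m" using a unfolding Ints_def by blast
      then show ?thesis using round_diff_minimal[of x m] by (simp add: dist_real_def)
    qed
    then show "\<bar>x - of_int (round x)\<bar> \<le> dist_int x"
      unfolding dist_int_def infdist_def by (auto intro!: cINF_greatest)
  qed
  then show ?thesis by blast
qed

lemma dist_int_le_half: "dist_int x \<le> 1/2"
  using dist_int_le_abs_diff[of x "round x"] of_int_round_abs_le[of x] by (simp add: abs_minus_commute)

lemma dist_int_add: "dist_int (x + y) \<le> dist_int x + dist_int y"
proof -
  obtain z w where "dist_int x = \<bar>x - of_int z\<bar>" "dist_int y = \<bar>y - of_int w\<bar>"
    using dist_int_attained by metis
  then show ?thesis using dist_int_le_abs_diff[of "x+y" "z+w"] by simp
qed

lemma dist_int_add_of_int [simp]: "dist_int (x + of_int z) = dist_int x"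
proof -
  have "dist_int (x + of_int z) \<le> dist_int x" for x z
    using dist_int_add[of x "of_int z"] by (simp add: dist_int_def)
  from this[of x z] this[of "x + of_int z" "-z"] show ?thesis by simp
qed

lemma dist_int_of_int_mult: "dist_int (of_int k * x) \<le> \<bar>of_int k\<bar> * dist_int x"
proof -
  obtain z where z: "dist_int x = \<bar>x - of_int z\<bar>" using dist_int_attained by blast
  have "dist_int (of_int k * x) \<le> \<bar>of_int k * x - of_int (k * z)\<bar>" by (rule dist_int_le_abs_diff)
  also have "\<dots> = \<bar>of_int k\<bar> * dist_int x"
    by (simp add: z abs_mult[symmetric] algebra_simps)
  finally show ?thesis .
qed

lemma dist_int_minus [simp]: "dist_int (- x) = dist_int x"
  using dist_int_of_int_mult[of "-1" x] dist_int_of_int_mult[of "-1" "-x"] by simp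

lemma dist_int_sum: "dist_int (sum f A) \<le> (\<Sum>i\<in>A. dist_int (f i))"
proof (induction A rule: infinite_finite_induct)
  case (insert x F)
  then show ?case using dist_int_add[of "f x" "sum f F"] by simp
qed (auto simp: dist_int_def)

lemma continuous_on_dist_int [continuous_intros]:
  "continuous_on S f \<Longrightarrow> continuous_on S (\<lambda>x. dist_int (f x))"
  unfolding dist_int_def by (intro continuous_intros) auto

lemma dist_int_measurable [measurable]: "dist_int \<in> borel_measurable borel"
  by (intro borel_measurable_continuous_onI continuous_intros)

text \<open>
  The sine is concave on the interval and so lies above its chord.
\<close>

lemma sin_ge_linear:
  fixes x :: real assumes "0 \<le> x" "x \<le> pi/2" shows "2 / pi * x \<le> sin x"
proof -
  have "concave_on {0..pi} (sin :: real \<Rightarrow> real)"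
    by (rule f''_le0_imp_concave[where f' = cos and f'' = "\<lambda>x. - sin x"])
       (auto intro!: derivative_eq_intros sin_ge_zero)
  then have "(1 - 2/pi*x) * sin 0 + (2/pi*x) * sin (pi/2) \<le> sin ((1 - 2/pi*x) *\<^sub>R 0 + (2/pi*x) *\<^sub>R (pi/2))"
    by (rule concave_onD) (use assms in \<open>auto simp: field_simps\<close>)
  then show ?thesis by simp
qed

lemma norm_cis_diff_one: "norm (cis t - 1) = 2 * \<bar>sin (t / 2)\<bar>"
  using dist_exp_i_1[of t] by (simp add: cis_conv_exp)

lemma cis_two_pi_of_int [simp]: "cis (2 * pi * of_int z) = 1"
  by (metis cis_multiple_2pi Ints_of_int)

lemma dist_int_le_norm_cis: "4 * dist_int \<theta> \<le> norm (1 - cis (2 * pi * \<theta>))"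
proof -
  obtain z where z: "dist_int \<theta> = \<bar>\<theta> - of_int z\<bar>" using dist_int_attained by blast
  define \<delta> where "\<delta> = \<theta> - of_int z"
  have d: "\<bar>\<delta>\<bar> \<le> 1/2" using dist_int_le_half[of \<theta>] z by (simp add: \<delta>_def)
  have "cis (2 * pi * \<theta>) = cis (2 * pi * \<delta>) * cis (2 * pi * of_int z)"
    by (simp add: cis_mult \<delta>_def algebra_simps del: cis_two_pi_of_int)
  then have "norm (1 - cis (2 * pi * \<theta>)) = 2 * \<bar>sin (pi * \<delta>)\<bar>"
    using norm_cis_diff_one[of "2 * pi * \<delta>"] by (simp add: norm_minus_commute)
  moreover have "2 * \<bar>\<delta>\<bar> \<le> \<bar>sin (pi * \<delta>)\<bar>"
  proof -
    have "2 / pi * (pi * \<bar>\<delta>\<bar>) \<le> sin (pi * \<bar>\<delta>\<bar>)" by (rule sin_ge_linear) (use d in auto)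
    also have "\<dots> \<le> \<bar>sin (pi * \<delta>)\<bar>" by (cases "\<delta> \<ge> 0") auto
    finally show ?thesis by simp
  qed
  ultimately show ?thesis by (simp add: z \<delta>_def)
qed

text \<open>
  A geometric sum with ratio \<open>z\<close> has norm at most \<open>2 / norm (1 - z)\<close>. The bound is multiplied out so that
  it stays meaningful when \<open>\<theta>\<close> is an integer.
\<close>

lemma norm_exponential_sum_le:
  "2 * dist_int \<theta> * norm (\<Sum>a\<in>{u..<v}. cis (2 * pi * (real a * \<theta>))) \<le> 1"
proof -
  let ?z = "cis (2 * pi * \<theta>)"
  have *: "(\<Sum>a\<in>{u..<v}. cis (2 * pi * (real a * \<theta>))) = ?z ^ u * (\<Sum>a<v-u. ?z ^ a)"
  proof -
    have "(\<Sum>a\<in>{u..<v}. cis (2 * pi * (real a * \<theta>))) = (\<Sum>a\<in>{u..<v}. ?z ^ a)"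
      proof -
      have "cis (2 * pi * (real a * \<theta>)) = ?z ^ a" for a
        by (subst Complex.DeMoivre) (simp add: mult_ac)
      then show ?thesis by simp
    qed
    also have "\<dots> = (\<Sum>a<v-u. ?z ^ (a + u))"
      by (rule sum.reindex_bij_witness[of _ "\<lambda>a. a + u" "\<lambda>a. a - u"]) auto
    finally show ?thesis by (simp add: power_add sum_distrib_left mult.commute)
  qed
  have "norm (1 - ?z) * norm (\<Sum>a<v-u. ?z ^ a) = norm (1 - ?z ^ (v-u))"
    by (simp add: norm_mult[symmetric] one_diff_power_eq)
  also have "\<dots> \<le> 2"
    using norm_triangle_ineq4[of 1 "?z ^ (v-u)"] by (simp add: norm_power)
  finally have "norm (1 - ?z) * norm (\<Sum>a<v-u. ?z ^ a) \<le> 2" .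
  moreover have "4 * dist_int \<theta> * norm (\<Sum>a<v-u. ?z ^ a) \<le> norm (1 - ?z) * norm (\<Sum>a<v-u. ?z ^ a)"
    by (intro mult_right_mono dist_int_le_norm_cis) auto
  ultimately show ?thesis unfolding * by (simp add: norm_mult norm_power)
qed

section \<open>Linear forms with a small multiplicative exponent\<close>

text \<open>
  For a real \<open>w\<close> strictly between the exponent and the critical value, the product is below
  \<open>n powr (- w)\<close> for finitely many \<open>n\<close> only. The constant \<open>c\<close> takes care of the finitely many exceptions: none of them has a vanishing
  product, because a zero at \<open>n\<close> repeats at all multiples of \<open>n\<close>.
\<close>

lemma product_lower_bound_of_mult_exponent:
  fixes \<alpha> :: "nat \<Rightarrow> real"
  assumes d: "d \<ge> 1"
    and ex: "mult_exponent d \<alpha> < (if d = 1 then \<infinity> else ereal (real d / (real d - 1)))"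
  obtains c w where "c > 0" "w \<ge> 0" "(real d - 1) * w < real d"
    "\<And>n. n \<ge> 1 \<Longrightarrow> c * real n powr (-w) \<le> (\<Prod>i=1..d. dist_int (real n * \<alpha> i))"
proof -
  let ?P = "\<lambda>n::nat. \<Prod>i=1..d. dist_int (real n * \<alpha> i)"
  obtain w0 where w0: "mult_exponent d \<alpha> < ereal w0"
    and w0': "ereal w0 < (if d = 1 then \<infinity> else ereal (real d / (real d - 1)))"
    using ereal_dense2[OF ex] by blast
  \<comment> \<open>A nonnegative exponent makes \<open>n powr (-w)\<close> decreasing in \<open>n\<close>; the critical value is positive, so
    replacing a negative exponent by 0 does not reach it.\<close>
  define w where "w = max w0 0"
  have w_less: "(real d - 1) * w < real d"
  proof (cases "d = 1")
    case False
    then have "w0 < real d / (real d - 1)" using w0' by simp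
    then have "w < real d / (real d - 1)" using d False by (auto simp: w_def)
    then show ?thesis using d False by (simp add: field_simps)
  qed (use d in auto)
  define F where "F = {n::nat. n \<ge> 1 \<and> ?P n < real n powr (-w)}"
  have finF: "finite F"
  proof (rule ccontr)
    assume "infinite F"
    moreover have "F \<subseteq> {n. n \<ge> 1 \<and> ?P n < real n powr (-w0)}"
    proof
      fix n assume n: "n \<in> F"
      then have "real n powr (-w) \<le> real n powr (-w0)" by (auto simp: F_def w_def intro!: powr_mono)
      then show "n \<in> {n. n \<ge> 1 \<and> ?P n < real n powr (-w0)}" using n by (auto simp: F_def)
    qed
    ultimately have "infinite {n. n \<ge> 1 \<and> ?P n < real n powr (-w0)}" using finite_subset by blast
    then have "ereal w0 \<le> mult_exponent d \<alpha>" unfolding mult_exponent_def by (intro SUP_upper) auto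
    then show False using w0 by simp
  qed
  have pos: "?P n > 0" if n: "n \<ge> 1" for n
  proof (rule ccontr)
    assume "\<not> ?P n > 0"
    then have "?P n = 0" by (simp add: prod_nonneg not_less order_antisym)
    then obtain i where i: "i \<in> {1..d}" "dist_int (real n * \<alpha> i) = 0" by auto
    have "n * j \<in> F" if "j \<ge> 1" for j
    proof -
      have "dist_int (real (n * j) * \<alpha> i) \<le> real j * dist_int (real n * \<alpha> i)"
        using dist_int_of_int_mult[of "int j" "real n * \<alpha> i"] by (simp add: mult_ac)
      then have "dist_int (real (n * j) * \<alpha> i) = 0" using i by (simp add: order_antisym)
      then have zero: "?P (n * j) = 0" using i by (intro prod_zero) auto
      moreover have "0 < real (n * j) powr (-w)" "n * j \<ge> 1" using n that by auto
      ultimately show ?thesis unfolding F_def mem_Collect_eq zero by blast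
    qed
    then have "(\<lambda>j. n * j) ` {1..} \<subseteq> F" by auto
    moreover have "infinite ((\<lambda>j. n * j) ` {1..})"
      using n by (subst finite_image_iff) (auto simp: inj_on_def infinite_Ici)
    ultimately show False using finF finite_subset by blast
  qed
  define c where "c = Min (insert 1 (?P ` F))"
  have "c > 0" using finF pos by (auto simp: c_def F_def)
  moreover have "c * real n powr (-w) \<le> ?P n" if n: "n \<ge> 1" for n
  proof (cases "n \<in> F")
    case True
    have "real n powr (-w) \<le> real n powr 0" using n by (intro powr_mono) (auto simp: w_def)
    then have "real n powr (-w) \<le> 1" using n by simp
    then have "c * real n powr (-w) \<le> c" using \<open>c > 0\<close> by (simp add: mult_left_le)
    also have "c \<le> ?P n" unfolding c_def using True finF by (intro Min_le) auto
    finally show ?thesis .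
  next
    case False
    have "c \<le> 1" unfolding c_def using finF by (intro Min_le) auto
    then have "c * real n powr (-w) \<le> 1 * real n powr (-w)" by (intro mult_right_mono) auto
    also have "\<dots> = real n powr (-w)" by simp
    also have "\<dots> \<le> ?P n" using False n by (auto simp: F_def)
    finally show ?thesis .
  qed
  ultimately show ?thesis using that[of c w] w_less by (auto simp: w_def)
qed

lemma simultaneous_approximation_except_one:
  fixes \<alpha> :: "nat \<Rightarrow> real"
  assumes l: "l \<in> {1..d}" and Q: "Q > 0"
  obtains m :: nat where "m \<ge> 1" "m \<le> Q ^ (d - 1)"
    "\<And>i. i \<in> {1..d} - {l} \<Longrightarrow> dist_int (real m * \<alpha> i) \<le> 1 / real Q"
proof -
  obtain f where f: "bij_betw f {0..<card ({1..d} - {l})} ({1..d} - {l})"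
    using ex_bij_betw_nat_finite[of "{1..d} - {l}"] by auto
  have c: "card ({1..d} - {l}) = d - 1" using l by simp
  obtain q p where q: "0 < q" "q \<le> int (Q ^ (d-1))"
    "\<And>i. i < d-1 \<Longrightarrow> \<bar>of_int q * \<alpha> (f i) - of_int (p i)\<bar> < 1 / Q"
    using Dirichlet_approx_simult[OF Q, of "d-1" "\<lambda>i. \<alpha> (f i)"] by metis
  show ?thesis
  proof (rule that[of "nat q"])
    fix i assume "i \<in> {1..d} - {l}"
    then have "i \<in> f ` {0..<d-1}" using f unfolding c bij_betw_def by auto
    then obtain j where j: "j < d-1" "i = f j" by auto
    have "dist_int (real (nat q) * \<alpha> i) \<le> \<bar>of_int q * \<alpha> (f j) - of_int (p j)\<bar>"
      using dist_int_le_abs_diff[of "of_int q * \<alpha> (f j)" "p j"] q(1) by (simp add: j)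
    then show "dist_int (real (nat q) * \<alpha> i) \<le> 1 / real Q" using q(3)[OF j(1)] by simp
  qed (use q in \<open>auto simp: nat_le_iff\<close>)
qed

text \<open>
  The transference step. Dirichlet's theorem provides \<open>m\<close> that is good for all coordinates except \<open>l\<close>.
  For \<open>n = \<bar>h l\<bar> * m\<close> the coordinate \<open>l\<close> is good as well, because \<open>h l * \<alpha> l\<close> is congruent modulo 1 to
  minus the other terms of the form, up to the small error assumed.
\<close>

lemma product_small_of_linear_form_small:
  fixes \<alpha> :: "nat \<Rightarrow> real" and h :: "nat \<Rightarrow> int"
  assumes l: "l \<in> {1..d}" "h l \<noteq> 0"
    and hH: "\<And>i. i \<in> {1..d} \<Longrightarrow> \<bar>h i\<bar> \<le> int H"
    and Q: "Q > 0"
    and small: "dist_int (\<Sum>i=1..d. of_int (h i) * \<alpha> i) \<le> real H / real Q ^ d"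
  obtains n :: nat where "n \<ge> 1" "n \<le> H * Q ^ (d - 1)"
    "(\<Prod>i=1..d. dist_int (real n * \<alpha> i)) \<le> (real d * real H / real Q) ^ d"
proof -
  let ?L = "\<Sum>i=1..d. of_int (h i) * \<alpha> i"
  obtain m where m: "m \<ge> 1" "m \<le> Q ^ (d - 1)"
    "\<And>i. i \<in> {1..d} - {l} \<Longrightarrow> dist_int (real m * \<alpha> i) \<le> 1 / real Q"
    using simultaneous_approximation_except_one[OF l(1) Q, of \<alpha>] by metis
  define n where "n = nat \<bar>h l\<bar> * m"
  have H: "H \<ge> 1" using hH[OF l(1)] l(2) by auto
  have nabs: "nat \<bar>h l\<bar> \<le> H" using hH[OF l(1)] by auto
  have d: "d \<ge> 1" using l by auto
  have n1: "n \<ge> 1" using m l(2) by (simp add: n_def)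
  have n2: "n \<le> H * Q ^ (d-1)" unfolding n_def by (rule mult_mono) (use nabs m in auto)
  have HQ: "real H / real Q \<le> real d * real H / real Q"
    using d H Q by (simp add: field_simps)
  have "dist_int (real n * \<alpha> i) \<le> real d * real H / real Q" if i: "i \<in> {1..d}" for i
  proof (cases "i = l")
    case False
    have "dist_int (real n * \<alpha> i) = dist_int (of_int \<bar>h l\<bar> * (real m * \<alpha> i))"
      by (simp add: n_def mult_ac)
    also have "\<dots> \<le> \<bar>of_int \<bar>h l\<bar>\<bar> * dist_int (real m * \<alpha> i)" by (rule dist_int_of_int_mult)
    also have "\<dots> \<le> real H * (1 / real Q)"
      by (intro mult_mono m(3)) (use i False nabs in \<open>auto\<close>)
    finally show ?thesis using HQ by simp
  next
    case True
    have sum_eq: "real m * ?L = of_int (h l) * (real m * \<alpha> l) + (\<Sum>i\<in>{1..d}-{l}. of_int (h i) * (real m * \<alpha> i))"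
    proof -
      have "real m * ?L = (\<Sum>i=1..d. of_int (h i) * (real m * \<alpha> i))"
        by (simp add: sum_distrib_left mult_ac)
      also have "\<dots> = of_int (h l) * (real m * \<alpha> l) + (\<Sum>i\<in>{1..d}-{l}. of_int (h i) * (real m * \<alpha> i))"
        by (rule sum.remove) (use l in auto)
      finally show ?thesis .
    qed
    have "dist_int (real n * \<alpha> l) = dist_int (of_int (h l) * (real m * \<alpha> l))"
      by (cases "h l \<ge> 0") (simp_all add: n_def mult_ac)
    also have "\<dots> = dist_int (of_int (int m) * ?L + - (\<Sum>i\<in>{1..d}-{l}. of_int (h i) * (real m * \<alpha> i)))"
      using sum_eq by simp
    also have "\<dots> \<le> dist_int (of_int (int m) * ?L) + dist_int (- (\<Sum>i\<in>{1..d}-{l}. of_int (h i) * (real m * \<alpha> i)))"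
      by (rule dist_int_add)
    also have "\<dots> \<le> real m * dist_int ?L + (\<Sum>i\<in>{1..d}-{l}. dist_int (of_int (h i) * (real m * \<alpha> i)))"
      using dist_int_of_int_mult[of "int m" ?L] by (intro add_mono) (auto intro: dist_int_sum)
    also have "\<dots> \<le> real Q ^ (d-1) * (real H / real Q ^ d) + (\<Sum>i\<in>{1..d}-{l}. real H * (1 / real Q))"
    proof (intro add_mono mult_mono sum_mono)
      show "real m \<le> real Q ^ (d-1)" using m(2) by (metis of_nat_le_iff of_nat_power)
      fix i assume i: "i \<in> {1..d} - {l}"
      have "dist_int (of_int (h i) * (real m * \<alpha> i)) \<le> \<bar>of_int (h i)\<bar> * dist_int (real m * \<alpha> i)"
        by (rule dist_int_of_int_mult)
      also have "\<dots> \<le> real H * (1 / real Q)"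
        by (intro mult_mono m(3)) (use i hH[of i] in auto)
      finally show "dist_int (of_int (h i) * (real m * \<alpha> i)) \<le> real H * (1 / real Q)" .
    qed (use small in auto)
    also have "real Q ^ (d-1) * (real H / real Q ^ d) = real H / real Q"
      using Q d by (cases d) auto
    also have "real H / real Q + (\<Sum>i\<in>{1..d}-{l}. real H * (1 / real Q)) = real d * real H / real Q"
      using l d by (simp add: of_nat_diff add_divide_distrib diff_divide_distrib algebra_simps)
    finally show ?thesis by (simp add: True)
  qed
  then have "(\<Prod>i=1..d. dist_int (real n * \<alpha> i)) \<le> (\<Prod>i=1..d. real d * real H / real Q)"
    by (intro prod_mono) auto
  then show ?thesis using that n1 n2 by simp
qed

text \<open>
  With \<open>Q\<close> as in the preceding lemma, a very small form gives \<open>n \<le> H * Q ^ (d - 1)\<close> whose product is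
  \<open>O(H / Q) ^ d\<close>. Comparing with the lower bound \<open>c * n powr (- w)\<close> yields \<open>Q powr \<kappa> = O(H powr (d + w))\<close> for
  \<open>\<kappa> = d - (d - 1) * w\<close>. Since \<open>\<kappa> > 0\<close>, this fails once \<open>Q\<close> is a large power of \<open>H\<close>.
\<close>

lemma linear_form_lower_bound:
  fixes \<alpha> :: "nat \<Rightarrow> real"
  assumes d: "d \<ge> 1"
    and ex: "mult_exponent d \<alpha> < (if d = 1 then \<infinity> else ereal (real d / (real d - 1)))"
  obtains B \<tau> :: nat where "B \<ge> 1"
    "\<And>H h. \<lbrakk>\<And>i. i \<in> {1..d} \<Longrightarrow> \<bar>h i\<bar> \<le> int H; \<exists>i\<in>{1..d}. h i \<noteq> 0\<rbrakk>
       \<Longrightarrow> 1 \<le> real B * real H ^ \<tau> * dist_int (\<Sum>i=1..d. of_int (h i) * \<alpha> i)"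
proof -
  obtain c w where c: "c > 0" "w \<ge> 0" "(real d - 1) * w < real d"
    "\<And>n. n \<ge> 1 \<Longrightarrow> c * real n powr (-w) \<le> (\<Prod>i=1..d. dist_int (real n * \<alpha> i))"
    using product_lower_bound_of_mult_exponent[OF d ex] by metis
  define \<kappa> where "\<kappa> = real d - (real d - 1) * w"
  have \<kappa>: "\<kappa> > 0" using c by (simp add: \<kappa>_def)
  \<comment> \<open>The choice \<open>Q = C * H ^ R\<close> violates the upper bound for \<open>Q powr \<kappa>\<close> for every \<open>H \<ge> 1\<close>.\<close>
  obtain R :: nat where R: "(real d + w) / \<kappa> \<le> real R" using real_arch_simple by blast
  obtain C :: nat where C: "(real d ^ d / c) powr (1/\<kappa>) + 1 \<le> real C" using real_arch_simple by blast
  have C1: "C \<ge> 1"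
  proof -
    have "1 \<le> (real d ^ d / c) powr (1/\<kappa>) + 1" by simp
    then show ?thesis using C by linarith
  qed
  have Ck: "real d ^ d / c < real C powr \<kappa>"
  proof -
    have "(real d ^ d / c) powr (1/\<kappa>) < real C" using C by simp
    then have "((real d ^ d / c) powr (1/\<kappa>)) powr \<kappa> < real C powr \<kappa>"
      using \<kappa> by (intro powr_less_mono2) auto
    then show ?thesis using \<kappa> c d by (simp add: powr_powr)
  qed
  show ?thesis
  proof (rule that[of "C ^ d" "R * d"])
    show "C ^ d \<ge> 1" using C1 by simp
    fix H :: nat and h :: "nat \<Rightarrow> int"
    assume hH: "\<And>i. i \<in> {1..d} \<Longrightarrow> \<bar>h i\<bar> \<le> int H" and "\<exists>i\<in>{1..d}. h i \<noteq> 0"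
    then obtain l where l: "l \<in> {1..d}" "h l \<noteq> 0" by blast
    have H: "H \<ge> 1" using hH[OF l(1)] l(2) by auto
    define Q where "Q = C * H ^ R"
    have Q: "Q > 0" using C1 H by (simp add: Q_def)
    let ?L = "\<Sum>i=1..d. of_int (h i) * \<alpha> i"
    have "\<not> dist_int ?L \<le> real H / real Q ^ d"
    proof
      assume "dist_int ?L \<le> real H / real Q ^ d"
      then obtain n where n: "n \<ge> 1" "n \<le> H * Q ^ (d-1)"
        "(\<Prod>i=1..d. dist_int (real n * \<alpha> i)) \<le> (real d * real H / real Q) ^ d"
        using product_small_of_linear_form_small[of l d h H Q \<alpha>] l hH Q by metis
      have "c * (real H * real Q ^ (d-1)) powr (-w) \<le> c * real n powr (-w)"
      proof (intro mult_left_mono)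
        have "real n \<le> real H * real Q ^ (d-1)" using n(2) by (metis of_nat_le_iff of_nat_mult of_nat_power)
        then show "(real H * real Q ^ (d-1)) powr (-w) \<le> real n powr (-w)"
          using n c by (intro powr_mono2') auto
      qed (use c in auto)
      also have "\<dots> \<le> (real d * real H / real Q) ^ d" using c(4)[OF n(1)] n(3) by simp
      finally have ineq: "c * (real H * real Q ^ (d-1)) powr (-w) \<le> (real d * real H / real Q) ^ d" .
      have "real Q ^ (d-1) = real Q powr (real d - 1)"
        using Q d by (simp add: powr_realpow[symmetric] of_nat_diff)
      then have e1: "(real H * real Q ^ (d-1)) powr (-w) = real H powr (-w) * real Q powr (\<kappa> - real d)"
        using H Q by (simp add: powr_mult powr_powr \<kappa>_def algebra_simps)
      have e2: "(real d * real H / real Q) ^ d = real d ^ d * real H powr d * real Q powr (- real d)"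
        using H Q by (simp add: power_divide power_mult_distrib powr_realpow powr_minus field_simps)
      have "c * real H powr (-w) * real Q powr \<kappa> = c * (real H powr (-w) * real Q powr (\<kappa> - real d)) * real Q powr d"
        by (simp add: powr_add[symmetric])
      also have "\<dots> \<le> (real d ^ d * real H powr d * real Q powr (- real d)) * real Q powr d"
        using ineq unfolding e1 e2 by (intro mult_right_mono) auto
      also have "\<dots> = real d ^ d * real H powr d" using Q by (simp add: powr_add[symmetric])
      finally have "c * real H powr (-w) * real Q powr \<kappa> * real H powr w \<le> real d ^ d * real H powr d * real H powr w"
        by (intro mult_right_mono) auto
      then have "c * real Q powr \<kappa> \<le> real d ^ d * real H powr (real d + w)"
        using H by (simp add: powr_add powr_minus field_simps)
      then have up: "real Q powr \<kappa> \<le> (real d ^ d / c) * real H powr (real d + w)"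
        using c by (simp add: field_simps)
      have "real H powr (real d + w) \<le> real H powr (real R * \<kappa>)"
        using H R \<kappa> by (intro powr_mono) (auto simp: field_simps)
      then have "(real d ^ d / c) * real H powr (real d + w) \<le> (real d ^ d / c) * real H powr (real R * \<kappa>)"
        using c by (intro mult_left_mono) auto
      also have "\<dots> < real C powr \<kappa> * real H powr (real R * \<kappa>)"
        using Ck H by (intro mult_strict_right_mono) auto
      also have "\<dots> = real Q powr \<kappa>"
        using H C1 by (simp add: Q_def powr_mult powr_powr powr_realpow[symmetric])
      finally show False using up by simp
    qed
    then have "real H / real Q ^ d < dist_int ?L" by simp
    moreover have "1 / real Q ^ d \<le> real H / real Q ^ d" using H by (intro divide_right_mono) auto
    ultimately have "1 / real Q ^ d \<le> dist_int ?L" by simp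
    then have "1 \<le> real Q ^ d * dist_int ?L" using Q by (simp add: field_simps)
    then show "1 \<le> real (C ^ d) * real H ^ (R * d) * dist_int ?L"
      by (simp add: Q_def power_mult_distrib power_mult)
  qed
qed

section \<open>Fejer weights and their averages over arithmetic progressions\<close>

text \<open>
  Expanding the squared norm in \<open>fejer_weight\<close> gives one exponential for each triple \<open>(j, a, b)\<close>, with
  coefficient \<open>1 / 2 ^ j\<close> and frequency \<open>a - b\<close>.
\<close>

definition fejer_index :: "nat \<Rightarrow> (nat \<times> nat \<times> nat) set" where
  "fejer_index J = (SIGMA j:{1..J}. {..<2^j} \<times> {..<2^j})"

text \<open>
  The sum of the Fejer kernels of orders \<open>2, 4, \<dots>, 2 ^ J\<close>. A single kernel is concentrated at one
  scale; summing over dyadic scales gives a nonnegative polynomial that is \<open>O(1 / dist_int x)\<close> and whose mean has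
  the order of that of \<open>1 / dist_int x\<close> cut off at height \<open>2 ^ J\<close>.
\<close>

definition fejer_weight :: "nat \<Rightarrow> real \<Rightarrow> real" where
  "fejer_weight J x = (\<Sum>j=1..J. (norm (\<Sum>a<2^j. cis (2 * pi * (real a * x))))\<^sup>2 / 2 ^ j)"

definition fejer_freq :: "nat \<times> nat \<times> nat \<Rightarrow> int" where
  "fejer_freq s = (case s of (j, a, b) \<Rightarrow> int a - int b)"

lemma finite_fejer_index [simp]: "finite (fejer_index J)"
  by (auto simp: fejer_index_def)

lemma fejer_weight_expansion:
  "of_real (fejer_weight J x) =
     (\<Sum>s\<in>fejer_index J. of_real (1 / 2 ^ fst s) * cis (2 * pi * (of_int (fejer_freq s) * x)))"
proof -
  have *: "of_real ((norm (\<Sum>a<2^j. cis (2 * pi * (real a * x))))\<^sup>2) =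
      (\<Sum>(a,b)\<in>{..<2^j}\<times>{..<2^j}. cis (2 * pi * (of_int (int a - int b) * x)))" for j
  proof -
    have "of_real ((norm (\<Sum>a<2^j. cis (2 * pi * (real a * x))))\<^sup>2) =
        (\<Sum>a<2^j. cis (2 * pi * (real a * x))) * (\<Sum>b<2^j. cnj (cis (2 * pi * (real b * x))))"
      by (simp only: complex_norm_square cnj_sum)
    also have "\<dots> = (\<Sum>a<2^j. \<Sum>b<2^j. cis (2 * pi * (of_int (int a - int b) * x)))"
      unfolding sum_product
      by (intro sum.cong refl) (simp add: cis_cnj cis_mult algebra_simps)
    finally show ?thesis by (simp add: sum.cartesian_product)
  qed
  have "of_real (fejer_weight J x) =
      (\<Sum>j=1..J. complex_of_real (1 / 2^j) * complex_of_real ((norm (\<Sum>a<2^j. cis (2 * pi * (real a * x))))\<^sup>2))"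
    by (simp add: fejer_weight_def)
  also have "\<dots> = (\<Sum>j=1..J. \<Sum>(a,b)\<in>{..<2^j}\<times>{..<2^j}. of_real (1 / 2^j) * cis (2 * pi * (of_int (int a - int b) * x)))"
    unfolding * by (simp only: sum_distrib_left case_prod_unfold)
  also have "\<dots> = (\<Sum>(j,a,b)\<in>fejer_index J. of_real (1 / 2^j) * cis (2 * pi * (of_int (int a - int b) * x)))"
    unfolding fejer_index_def by (subst sum.Sigma) (auto simp: case_prod_unfold)
  also have "\<dots> = (\<Sum>s\<in>fejer_index J. of_real (1 / 2 ^ fst s) * cis (2 * pi * (of_int (fejer_freq s) * x)))"
    by (intro sum.cong) (auto simp: fejer_freq_def)
  finally show ?thesis .
qed

lemma abs_fejer_freq_less: "s \<in> fejer_index J \<Longrightarrow> \<bar>fejer_freq s\<bar> \<le> int (2 ^ J)"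
proof -
  assume "s \<in> fejer_index J"
  then obtain j a b where s: "s = (j,a,b)" "j \<le> J" "a < 2^j" "b < 2^j"
    by (auto simp: fejer_index_def)
  have "(2::nat)^j \<le> 2^J" using s by (intro power_increasing) auto
  then have "a < 2^J" "b < 2^J" using s(3,4) by (blast intro: less_le_trans)+
  then have "\<bar>int a - int b\<bar> \<le> int (2^J)" by linarith
  then show ?thesis by (simp add: s fejer_freq_def)
qed

lemma sum_fejer_coeff_diagonal:
  "(\<Sum>s\<in>{s\<in>fejer_index J. fejer_freq s = 0}. 1 / 2 ^ fst s) = real J"
proof -
  have "(\<Sum>s\<in>{s\<in>fejer_index J. fejer_freq s = 0}. 1 / 2 ^ fst s) = (\<Sum>(j,a)\<in>(SIGMA j:{1..J}. {..<2^j::nat}). 1 / (2::real) ^ j)"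
    by (rule sum.reindex_bij_witness[of _ "\<lambda>(j,a). (j,a,a)" "\<lambda>(j,a,b). (j,a)"])
       (auto simp: fejer_index_def fejer_freq_def)
  also have "\<dots> = (\<Sum>j=1..J. \<Sum>a<2^j::nat. 1 / (2::real) ^ j)"
    by (subst sum.Sigma) auto
  finally show ?thesis by simp
qed

lemma sum_fejer_coeff_le: "(\<Sum>s\<in>fejer_index J. 1 / 2 ^ fst s) \<le> (2::real) * 2 ^ J"
proof -
  have "(\<Sum>s\<in>fejer_index J. 1 / 2 ^ fst s) = (\<Sum>j=1..J. \<Sum>p\<in>{..<2^j::nat} \<times> {..<2^j::nat}. 1 / (2::real) ^ j)"
    unfolding fejer_index_def by (subst sum.Sigma) (auto simp: case_prod_unfold)
  also have "\<dots> = (\<Sum>j=1..J. 2 ^ j)" by (simp add: power_mult_distrib)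
  also have "\<dots> \<le> 2 * 2 ^ J" by (induction J) auto
  finally show ?thesis .
qed

lemma fejer_weight_nonneg: "fejer_weight J x \<ge> 0"
  by (auto simp: fejer_weight_def intro!: sum_nonneg)

lemma fejer_weight_le: "fejer_weight J x \<le> 2 * 2 ^ J"
proof -
  have "fejer_weight J x = norm (of_real (fejer_weight J x) :: complex)"
    using fejer_weight_nonneg[of J x] by simp
  also have "\<dots> \<le> (\<Sum>s\<in>fejer_index J. norm (complex_of_real (1 / 2 ^ fst s) * cis (2 * pi * (of_int (fejer_freq s) * x))))"
    unfolding fejer_weight_expansion by (rule norm_sum)
  also have "\<dots> = (\<Sum>s\<in>fejer_index J. 1 / 2 ^ fst s)"
    by (simp add: norm_mult norm_divide norm_power)
  finally show ?thesis using sum_fejer_coeff_le[of J] by linarith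
qed

text \<open>
  With \<open>u = dist_int x\<close>, the kernel of order \<open>2 ^ j\<close> is at most \<open>min (2 ^ j) (1 / (4 * 2 ^ j * u\<^sup>2))\<close>. The first
  bound is summed while \<open>2 ^ j * u \<le> 1\<close>, the second one afterwards; both are geometric sums dominated
  by the terms near \<open>2 ^ j = 1 / u\<close>. The subtracted term in the inductive claim leaves room for the tail.
\<close>

lemma fejer_weight_mult_dist_int_le: "fejer_weight J x * dist_int x \<le> 3"
proof -
  define u where "u = dist_int x"
  show ?thesis
  proof (cases "u = 0")
    case False
    then have u: "u > 0" using dist_int_nonneg[of x] by (simp add: u_def order_less_le)
    have big: "fejer_weight J x * u \<le> 3 - 1 / (4 * (2^J * u))" if "1 < 2^J * u" for J
      using that
    proof (induction J)
      case 0
      then show ?case using dist_int_le_half[of x] by (simp add: u_def)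
    next
      case (Suc J)
      define y where "y = 2 ^ Suc J * u"
      define T where "T = norm (\<Sum>a<2^Suc J. cis (2 * pi * (real a * x)))"
      have step: "fejer_weight (Suc J) x = fejer_weight J x + T\<^sup>2 / 2 ^ Suc J"
        by (simp add: fejer_weight_def T_def)
      have "2 * u * T \<le> 1"
        using norm_exponential_sum_le[of x 0 "2^Suc J"] by (simp add: u_def T_def atLeast0LessThan)
      then have "(2 * u * T)\<^sup>2 \<le> 1" using u by (intro power_le_one) (auto simp: T_def)
      then have "T\<^sup>2 / 2 ^ Suc J * u \<le> 1 / (4 * y)"
        using u by (simp add: y_def field_simps power2_eq_square)
      then have le: "fejer_weight (Suc J) x * u \<le> fejer_weight J x * u + 1 / (4 * y)"
        by (simp add: step algebra_simps)
      show ?case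
      proof (cases "1 < 2 ^ J * u")
        case True
        have "fejer_weight J x * u \<le> 3 - 1 / (4 * (2^J * u))" by (rule Suc.IH[OF True])
        also have "1 / (4 * (2 ^ J * u)) = 2 * (1 / (4 * y))" by (simp add: y_def)
        finally show ?thesis using le unfolding y_def by linarith
      next
        case False
        have y: "1 < y" "y \<le> 2" using False Suc.prems by (auto simp: y_def)
        have "fejer_weight J x * u \<le> 2 * 2 ^ J * u"
          using u by (intro mult_right_mono fejer_weight_le) auto
        then have "fejer_weight (Suc J) x * u \<le> y + 1 / (4 * y)" using le by (simp add: y_def)
        also have "\<dots> \<le> 3 - 1 / (4 * y)"
        proof -
          have "1 / (4 * y) \<le> 1 / 4" using y by (simp add: field_simps)
          then show ?thesis using y by linarith
        qed
        finally show ?thesis by (simp add: y_def)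
      qed
    qed
    show ?thesis
    proof (cases "1 < 2^J * u")
      case True
      have "0 \<le> 1 / (4 * (2^J * u))" using u by simp
      then show ?thesis using big[OF True] unfolding u_def by linarith
    next
      case False
      have "fejer_weight J x * u \<le> 2 * 2 ^ J * u"
        using u by (intro mult_right_mono fejer_weight_le) auto
      then show ?thesis using False by (simp add: u_def)
    qed
  qed (auto simp: u_def)
qed

text \<open>
  A trigonometric polynomial in \<open>n\<close> that stands in for the reciprocal of the product of the distances
  \<open>dist_int (n * \<alpha> i - \<gamma> i)\<close>. It replaces counting points of the Bohr sets in which these distances have given
  sizes.
\<close>

definition bohr_weight :: "nat \<Rightarrow> (nat \<Rightarrow> real) \<Rightarrow> (nat \<Rightarrow> real) \<Rightarrow> nat \<Rightarrow> nat \<Rightarrow> real" where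
  "bohr_weight d \<alpha> \<gamma> J n = (\<Prod>i=1..d. fejer_weight J (real n * \<alpha> i - \<gamma> i))"

lemma bohr_weight_nonneg: "bohr_weight d \<alpha> \<gamma> J n \<ge> 0"
  by (auto simp: bohr_weight_def intro!: prod_nonneg fejer_weight_nonneg)

lemma bohr_weight_le: "bohr_weight d \<alpha> \<gamma> J n \<le> (2 * 2 ^ J) ^ d"
proof -
  have "bohr_weight d \<alpha> \<gamma> J n \<le> (\<Prod>i=1..d. 2 * 2 ^ J)"
    unfolding bohr_weight_def by (intro prod_mono conjI fejer_weight_nonneg fejer_weight_le)
  then show ?thesis by simp
qed

lemma bohr_weight_mult_prod_le:
  "bohr_weight d \<alpha> \<gamma> J n * (\<Prod>i=1..d. dist_int (real n * \<alpha> i - \<gamma> i)) \<le> 3 ^ d"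
proof -
  have "bohr_weight d \<alpha> \<gamma> J n * (\<Prod>i=1..d. dist_int (real n * \<alpha> i - \<gamma> i))
      \<le> (\<Prod>i=1..d. 3)"
    unfolding bohr_weight_def prod.distrib[symmetric]
    by (intro prod_mono conjI mult_nonneg_nonneg fejer_weight_nonneg fejer_weight_mult_dist_int_le) auto
  then show ?thesis by simp
qed

text \<open>
  The product of the weights expands into exponentials indexed by tuples of triples. The tuples with all
  frequencies zero have total coefficient \<open>J ^ d\<close> and give the main term; for each other tuple the sum over
  \<open>m\<close> is a geometric sum, bounded by means of the hypothesis on linear forms.
\<close>

lemma sum_bohr_weight_multiples:
  fixes \<alpha> \<gamma> :: "nat \<Rightarrow> real"
  assumes lb: "\<And>h. \<lbrakk>\<And>i. i \<in> {1..d} \<Longrightarrow> \<bar>h i\<bar> \<le> int (2 ^ J); \<exists>i\<in>{1..d}. h i \<noteq> 0\<rbrakk>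
       \<Longrightarrow> 1 \<le> D * dist_int (real q * (\<Sum>i=1..d. of_int (h i) * \<alpha> i))"
    and D: "D \<ge> 0"
  shows "\<bar>(\<Sum>m\<in>{u..<v}. bohr_weight d \<alpha> \<gamma> J (q * m)) - real (v - u) * real J ^ d\<bar> \<le> (2 * 2 ^ J) ^ d * D"
proof -
  define G where "G = PiE {1..d} (\<lambda>_. fejer_index J)"
  define c where "c = (\<lambda>g::nat \<Rightarrow> nat \<times> nat \<times> nat. \<Prod>i=1..d. 1 / (2::real) ^ fst (g i))"
  define fr where "fr = (\<lambda>g::nat \<Rightarrow> nat \<times> nat \<times> nat. \<Sum>i=1..d. of_int (fejer_freq (g i)) * \<alpha> i)"
  define fg where "fg = (\<lambda>g::nat \<Rightarrow> nat \<times> nat \<times> nat. \<Sum>i=1..d. of_int (fejer_freq (g i)) * \<gamma> i)"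
  define G0 where "G0 = PiE {1..d} (\<lambda>_. {s\<in>fejer_index J. fejer_freq s = 0})"
  have fin: "finite G" unfolding G_def by (intro finite_PiE) auto
  have G0: "G0 \<subseteq> G" unfolding G_def G0_def by (intro PiE_mono) auto
  have cnn: "c g \<ge> 0" for g by (auto simp: c_def intro!: prod_nonneg)
  have cis_sum: "(\<Prod>i\<in>A. cis (f i)) = cis (sum f A)" for f and A :: "nat set"
    by (induction A rule: infinite_finite_induct) (auto simp: cis_mult)
  have expand: "complex_of_real (bohr_weight d \<alpha> \<gamma> J n) =
      (\<Sum>g\<in>G. of_real (c g) * cis (- 2 * pi * fg g) * cis (2 * pi * (real n * fr g)))" for n
  proof -
    have "complex_of_real (bohr_weight d \<alpha> \<gamma> J n) =
      (\<Prod>i=1..d. \<Sum>s\<in>fejer_index J. of_real (1 / 2 ^ fst s) * cis (2 * pi * (of_int (fejer_freq s) * (real n * \<alpha> i - \<gamma> i))))"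
      unfolding bohr_weight_def of_real_prod fejer_weight_expansion ..
    also have "\<dots> = (\<Sum>g\<in>G. \<Prod>i=1..d. of_real (1 / 2 ^ fst (g i)) * cis (2 * pi * (of_int (fejer_freq (g i)) * (real n * \<alpha> i - \<gamma> i))))"
      unfolding G_def by (rule prod_sum_PiE) auto
    also have "\<dots> = (\<Sum>g\<in>G. of_real (c g) * cis (- 2 * pi * fg g) * cis (2 * pi * (real n * fr g)))"
    proof (rule sum.cong)
      fix g
      have "(\<Sum>i=1..d. 2 * pi * (of_int (fejer_freq (g i)) * (real n * \<alpha> i - \<gamma> i))) = - 2 * pi * fg g + 2 * pi * (real n * fr g)"
        by (simp add: fr_def fg_def sum_distrib_left sum_negf[symmetric] sum.distrib[symmetric] algebra_simps)
      then have "(\<Prod>i=1..d. cis (2 * pi * (of_int (fejer_freq (g i)) * (real n * \<alpha> i - \<gamma> i)))) = cis (- 2 * pi * fg g) * cis (2 * pi * (real n * fr g))"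
        by (simp only: cis_sum cis_mult)
      then show "(\<Prod>i=1..d. of_real (1 / 2 ^ fst (g i)) * cis (2 * pi * (of_int (fejer_freq (g i)) * (real n * \<alpha> i - \<gamma> i)))) = of_real (c g) * cis (- 2 * pi * fg g) * cis (2 * pi * (real n * fr g))"
        unfolding prod.distrib c_def by simp
    qed simp
    finally show ?thesis .
  qed
  define S where "S = (\<lambda>g. of_real (c g) * cis (- 2 * pi * fg g) * (\<Sum>m\<in>{u..<v}. cis (2 * pi * (real m * (real q * fr g)))))"
  have total: "complex_of_real (\<Sum>m\<in>{u..<v}. bohr_weight d \<alpha> \<gamma> J (q * m)) = (\<Sum>g\<in>G. S g)"
    unfolding of_real_sum expand S_def sum_distrib_left
    by (subst sum.swap) (simp add: mult_ac)
  have sumc: "(\<Sum>g\<in>G. c g) \<le> (2 * 2 ^ J) ^ d"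
  proof -
    have "(\<Sum>g\<in>G. c g) = (\<Prod>i=1..d. \<Sum>s\<in>fejer_index J. 1 / (2::real) ^ fst s)"
      unfolding G_def c_def by (rule prod_sum_PiE[symmetric]) auto
    also have "\<dots> \<le> (\<Prod>i=1..d. 2 * 2 ^ J)"
      by (intro prod_mono conjI sum_fejer_coeff_le sum_nonneg) auto
    finally show ?thesis by simp
  qed
  have sumc0: "(\<Sum>g\<in>G0. c g) = real J ^ d"
  proof -
    have "(\<Sum>g\<in>G0. c g) = (\<Prod>i=1..d. \<Sum>s\<in>{s\<in>fejer_index J. fejer_freq s = 0}. 1 / (2::real) ^ fst s)"
      unfolding G0_def c_def by (rule prod_sum_PiE[symmetric]) auto
    then show ?thesis by (simp only: sum_fejer_coeff_diagonal) simp
  qed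
  have S0: "S g = of_real (c g * real (v - u))" if "g \<in> G0" for g
  proof -
    have "fr g = 0" "fg g = 0" using that by (auto simp: G0_def fr_def fg_def PiE_iff)
    then show ?thesis by (simp add: S_def)
  qed
  have S1: "norm (S g) \<le> c g * D" if g: "g \<in> G - G0" for g
  proof -
    let ?T = "\<Sum>m\<in>{u..<v}. cis (2 * pi * (real m * (real q * fr g)))"
    have "1 \<le> D * dist_int (real q * fr g)"
      unfolding fr_def
    proof (rule lb)
      show "\<bar>fejer_freq (g i)\<bar> \<le> int (2 ^ J)" if "i \<in> {1..d}" for i
        using g that by (intro abs_fejer_freq_less) (auto simp: G_def)
      show "\<exists>i\<in>{1..d}. fejer_freq (g i) \<noteq> 0"
        using g by (auto simp: G_def G0_def PiE_iff)
    qed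
    then have "1 * norm ?T \<le> D * dist_int (real q * fr g) * norm ?T"
      by (intro mult_right_mono) auto
    also have "\<dots> \<le> D * (2 * dist_int (real q * fr g) * norm ?T)"
      using D by (simp add: mult_left_mono mult_right_mono)
    also have "\<dots> \<le> D * 1" by (intro mult_left_mono norm_exponential_sum_le D)
    finally have "norm ?T \<le> D" by simp
    then show ?thesis using cnn[of g] by (simp add: S_def norm_mult mult_left_mono)
  qed
  have "complex_of_real ((\<Sum>m\<in>{u..<v}. bohr_weight d \<alpha> \<gamma> J (q * m)) - real (v - u) * real J ^ d)
     = (\<Sum>g\<in>G. S g) - (\<Sum>g\<in>G0. S g)"
  proof -
    have "(\<Sum>g\<in>G0. S g) = of_real ((\<Sum>g\<in>G0. c g) * real (v - u))"
      using S0 by (simp add: sum_distrib_right)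
    then show ?thesis using total sumc0 by (simp add: mult.commute)
  qed
  also have "\<dots> = (\<Sum>g\<in>G - G0. S g)" using fin G0 by (simp add: sum_diff)
  finally have "\<bar>(\<Sum>m\<in>{u..<v}. bohr_weight d \<alpha> \<gamma> J (q * m)) - real (v - u) * real J ^ d\<bar> = norm (\<Sum>g\<in>G - G0. S g)"
    by (metis norm_of_real)
  also have "\<dots> \<le> (\<Sum>g\<in>G - G0. c g * D)" by (intro sum_norm_le S1)
  also have "\<dots> \<le> (\<Sum>g\<in>G. c g * D)" using fin D cnn by (intro sum_mono2) auto
  also have "\<dots> = (\<Sum>g\<in>G. c g) * D" by (simp add: sum_distrib_right)
  also have "\<dots> \<le> (2 * 2 ^ J) ^ d * D" by (intro mult_right_mono sumc D)
  finally show ?thesis .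
qed

section \<open>Averages of the weights against Euler's function\<close>

text \<open>
  The union bound: a number in \<open>{1..n}\<close> that is not coprime to \<open>n\<close> is a multiple of a prime factor of \<open>n\<close>.
\<close>

lemma card_totatives_ge:
  assumes "n > 0"
  shows "real (card (totatives n)) \<ge> real n - (\<Sum>p\<in>prime_factors n. real n / real p)"
proof -
  have cover: "{1..n} \<subseteq> totatives n \<union> (\<Union>p\<in>prime_factors n. (\<lambda>j. p * j) ` {1..n div p})"
  proof
    fix a assume a: "a \<in> {1..n}"
    show "a \<in> totatives n \<union> (\<Union>p\<in>prime_factors n. (\<lambda>j. p * j) ` {1..n div p})"
    proof (cases "coprime a n")
      case True
      then show ?thesis using a by (auto simp: totatives_def)
    next
      case False
      then obtain p where p: "prime p" "p dvd a" "p dvd n"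
      proof -
        have "gcd a n \<noteq> 1" using False by (simp add: coprime_iff_gcd_eq_1)
        then obtain p where "prime p" "p dvd gcd a n" using prime_factor_nat by blast
        then show ?thesis using that[of p] by simp
      qed
      then obtain j where j: "a = p * j" by (auto elim: dvdE)
      have "p > 0" using p prime_gt_0_nat by blast
      have "j \<le> n div p" using a j \<open>p > 0\<close> by (simp add: less_eq_div_iff_mult_less_eq mult.commute)
      moreover have "j \<ge> 1" using a j by (cases j) auto
      moreover have "p \<in> prime_factors n" using p assms by (simp add: prime_factors_dvd)
      ultimately have "a \<in> (\<lambda>j. p * j) ` {1..n div p}" "p \<in> prime_factors n" using j by auto
      then show ?thesis by blast
    qed
  qed
  have "n = card {1..n}" by simp
  also have "\<dots> \<le> card (totatives n \<union> (\<Union>p\<in>prime_factors n. (\<lambda>j. p * j) ` {1..n div p}))"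
    by (rule card_mono[OF _ cover]) auto
  also have "\<dots> \<le> card (totatives n) + (\<Sum>p\<in>prime_factors n. card ((\<lambda>j. p * j) ` {1..n div p}))"
    by (rule order.trans[OF card_Un_le]) (auto intro!: card_UN_le)
  also have "\<dots> \<le> card (totatives n) + (\<Sum>p\<in>prime_factors n. n div p)"
    by (intro add_left_mono sum_mono order.trans[OF card_image_le]) auto
  finally have "real n \<le> real (card (totatives n)) + (\<Sum>p\<in>prime_factors n. real (n div p))"
    by (metis of_nat_add of_nat_le_iff of_nat_sum)
  also have "\<dots> \<le> real (card (totatives n)) + (\<Sum>p\<in>prime_factors n. real n / real p)"
    by (intro add_left_mono sum_mono of_nat_div_le_of_nat)
  finally show ?thesis by simp
qed

lemma power_card_prime_factors_le:
  assumes "n > 0" shows "(2::nat) ^ card (prime_factors n) \<le> n"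
proof -
  have "(2::nat) ^ card (prime_factors n) = (\<Prod>p\<in>prime_factors n. 2)" by simp
  also have "\<dots> \<le> (\<Prod>p\<in>prime_factors n. p ^ multiplicity p n)"
  proof (intro prod_mono conjI)
    fix p assume p: "p \<in> prime_factors n"
    then have "p \<ge> 2" "multiplicity p n \<ge> 1"
      by (auto simp: prime_factors_multiplicity prime_ge_2_nat)
    then have "p ^ 1 \<le> p ^ multiplicity p n" by (intro power_increasing) auto
    then show "2 \<le> p ^ multiplicity p n" using \<open>p \<ge> 2\<close> by simp
  qed auto
  also have "\<dots> = n" using assms by (simp add: prime_factorization_nat[symmetric])
  finally show ?thesis .
qed

text \<open>
  The extra term \<open>1 / K\<close> makes the induction telescope.
\<close>

lemma sum_inverse_squares_le: "K \<ge> 2 \<Longrightarrow> (\<Sum>q=2..K. 1 / (real q)\<^sup>2) \<le> 3 / 4 - 1 / real K"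
proof (induction K rule: dec_induct)
  case base
  then show ?case by (simp add: power2_eq_square)
next
  case (step K)
  have "1 / (real (Suc K))\<^sup>2 \<le> 1 / (real K * real (Suc K))"
    using step.hyps by (intro divide_left_mono) (auto simp: power2_eq_square)
  also have "\<dots> = 1 / real K - 1 / real (Suc K)" using step.hyps by (simp add: field_simps)
  finally have "1 / (real (Suc K))\<^sup>2 \<le> 1 / real K - 1 / real (Suc K)" .
  then show ?case using step by (simp add: sum.atLeast_Suc_atMost_Suc_shift del: of_nat_Suc)
qed

lemma sum_multiples_block:
  fixes f :: "nat \<Rightarrow> real"
  assumes "q > 0"
  shows "(\<Sum>n\<in>{n\<in>{N<..2*N}. q dvd n}. f n) = (\<Sum>m\<in>{N div q + 1..<2*N div q + 1}. f (q * m))"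
proof (rule sum.reindex_bij_witness[of _ "\<lambda>m. q * m" "\<lambda>n. n div q"])
  fix n assume n: "n \<in> {n\<in>{N<..2*N}. q dvd n}"
  then obtain m where m: "n = q * m" by (auto elim: dvdE)
  show "q * (n div q) = n" using assms m by simp
  have "N < m * q" "m * q \<le> 2 * N" using n m by (auto simp: mult.commute)
  then have "N div q < m" "m \<le> 2 * N div q"
    using assms by (simp_all add: div_less_iff_less_mult less_eq_div_iff_mult_less_eq)
  then show "n div q \<in> {N div q + 1..<2*N div q + 1}" using assms m by simp
  show "f (q * (n div q)) = f n" using assms m by simp
next
  fix m assume "m \<in> {N div q + 1..<2*N div q + 1}"
  then have "N div q < m" "m \<le> 2 * N div q" by auto
  then have "N < m * q" "m * q \<le> 2 * N"
    using assms by (simp_all add: div_less_iff_less_mult less_eq_div_iff_mult_less_eq)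
  then show "q * m \<in> {n\<in>{N<..2*N}. q dvd n}" by (simp add: mult.commute)
  show "q * m div q = m" using assms by simp
qed

text \<open>
  The prime factors up to \<open>K\<close> are replaced by all divisors in \<open>{2..K}\<close>, which are easier to average over.
  There are at most \<open>t + 1\<close> larger ones, each contributing at most \<open>1 / K\<close>.
\<close>

lemma totient_density_ge:
  assumes "n > 0" "n \<le> 2 ^ (t + 1)" "K \<ge> 1"
  shows "real (card (totatives n)) / real n \<ge> 1 - (\<Sum>q\<in>{q\<in>{2..K}. q dvd n}. 1 / real q) - (real t + 1) / real K"
proof -
  let ?P = "prime_factors n"
  have "(\<Sum>p\<in>?P. 1 / real p) \<le> (\<Sum>p\<in>{p\<in>?P. p \<le> K}. 1 / real p) + (\<Sum>p\<in>{p\<in>?P. \<not> p \<le> K}. 1 / real p)"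
  proof -
    have "?P = {p\<in>?P. p \<le> K} \<union> {p\<in>?P. \<not> p \<le> K}" by auto
    then show ?thesis by (subst sum.union_disjoint[symmetric]) auto
  qed
  also have "(\<Sum>p\<in>{p\<in>?P. p \<le> K}. 1 / real p) \<le> (\<Sum>q\<in>{q\<in>{2..K}. q dvd n}. 1 / real q)"
    by (rule sum_mono2) (auto simp: in_prime_factors_iff prime_ge_2_nat)
  also have "(\<Sum>p\<in>{p\<in>?P. \<not> p \<le> K}. 1 / real p) \<le> (real t + 1) / real K"
  proof -
    have "(\<Sum>p\<in>{p\<in>?P. \<not> p \<le> K}. 1 / real p) \<le> (\<Sum>p\<in>{p\<in>?P. \<not> p \<le> K}. 1 / real K)"
      using assms by (intro sum_mono divide_left_mono) auto
    also have "\<dots> = real (card {p\<in>?P. \<not> p \<le> K}) / real K" by simp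
    also have "\<dots> \<le> (real t + 1) / real K"
    proof (intro divide_right_mono)
      have "(2::nat) ^ card ?P \<le> 2 ^ (t + 1)" using power_card_prime_factors_le[of n] assms by linarith
      then have "card ?P \<le> t + 1" by (rule power_le_imp_le_exp[rotated]) simp
      moreover have "card {p\<in>?P. \<not> p \<le> K} \<le> card ?P" by (rule card_mono) auto
      ultimately show "real (card {p\<in>?P. \<not> p \<le> K}) \<le> real t + 1" by linarith
    qed simp
    finally show ?thesis .
  qed
  finally have *: "(\<Sum>p\<in>?P. 1 / real p) \<le> (\<Sum>q\<in>{q\<in>{2..K}. q dvd n}. 1 / real q) + (real t + 1) / real K"
    by simp
  have "real n - real n * (\<Sum>p\<in>?P. 1 / real p) \<le> real (card (totatives n))"
    using card_totatives_ge[OF assms(1)] by (simp add: sum_distrib_left)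
  then have "real n * (1 - (\<Sum>p\<in>?P. 1 / real p)) \<le> real (card (totatives n))" by (simp add: algebra_simps)
  then have "1 - (\<Sum>p\<in>?P. 1 / real p) \<le> real (card (totatives n)) / real n"
    using assms by (simp add: field_simps)
  then show ?thesis using * by linarith
qed

text \<open>
  On multiples of \<open>q\<close> the relevant forms are those with coefficients \<open>q * h i\<close>, of size at most
  \<open>2 ^ J * 2 ^ J\<close>.
\<close>

lemma sum_bohr_weight_block:
  fixes \<alpha> \<gamma> :: "nat \<Rightarrow> real"
  assumes lb: "\<And>H h. \<lbrakk>\<And>i. i \<in> {1..d} \<Longrightarrow> \<bar>h i\<bar> \<le> int H; \<exists>i\<in>{1..d}. h i \<noteq> 0\<rbrakk>
       \<Longrightarrow> 1 \<le> real B * real H ^ \<tau> * dist_int (\<Sum>i=1..d. of_int (h i) * \<alpha> i)"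
    and q: "1 \<le> q" "q \<le> 2 ^ J"
  shows "\<bar>(\<Sum>n\<in>{n\<in>{N<..2*N}. q dvd n}. bohr_weight d \<alpha> \<gamma> J n) - real (2 * N div q - N div q) * real J ^ d\<bar>
     \<le> (2 * 2 ^ J) ^ d * (real B * (2 ^ J * 2 ^ J) ^ \<tau>)"
proof -
  have "\<bar>(\<Sum>m\<in>{N div q + 1..<2*N div q + 1}. bohr_weight d \<alpha> \<gamma> J (q * m))
      - real ((2 * N div q + 1) - (N div q + 1)) * real J ^ d\<bar>
     \<le> (2 * 2 ^ J) ^ d * (real B * real (2 ^ J * 2 ^ J) ^ \<tau>)"
  proof (rule sum_bohr_weight_multiples)
    fix h :: "nat \<Rightarrow> int"
    assume h: "\<And>i. i \<in> {1..d} \<Longrightarrow> \<bar>h i\<bar> \<le> int (2 ^ J)" "\<exists>i\<in>{1..d}. h i \<noteq> 0"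
    have "1 \<le> real B * real (2 ^ J * 2 ^ J) ^ \<tau> * dist_int (\<Sum>i=1..d. of_int (int q * h i) * \<alpha> i)"
    proof (rule lb)
      show "\<bar>int q * h i\<bar> \<le> int (2 ^ J * 2 ^ J)" if "i \<in> {1..d}" for i
      proof -
        have "int q \<le> int (2 ^ J)" using q by (simp only: of_nat_le_iff)
        then have "int q * \<bar>h i\<bar> \<le> int (2 ^ J) * int (2 ^ J)" using h(1)[OF that] by (intro mult_mono) auto
        then show ?thesis by (simp add: abs_mult)
      qed
      show "\<exists>i\<in>{1..d}. int q * h i \<noteq> 0" using h(2) q by auto
    qed
    then show "1 \<le> real B * real (2 ^ J * 2 ^ J) ^ \<tau> * dist_int (real q * (\<Sum>i=1..d. of_int (h i) * \<alpha> i))"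
      by (simp add: sum_distrib_left mult_ac)
  qed simp
  then show ?thesis using q sum_multiples_block[where q = q and N = N and f = "bohr_weight d \<alpha> \<gamma> J"] by simp
qed

text \<open>
  Put \<open>N = 2 ^ t\<close>, \<open>K = 2 ^ J\<close> and \<open>X = N * J ^ d\<close>. The error terms of \<open>sum_bohr_weight_block\<close>, summed over
  \<open>q \<le> K\<close>, are at most a constant times \<open>K ^ (L - 1)\<close>, whereas \<open>N \<ge> K ^ L\<close>; large \<open>J\<close> makes them a small fraction of \<open>X\<close>. By
  \<open>totient_density_ge\<close>, weighting with the density of reduced residues loses at most
  \<open>\<Sum>q. X / q\<^sup>2 \<le> 3 / 4 * X\<close> and small errors; of the remaining quarter, one eighth is kept.
\<close>

lemma bohr_weight_block_estimates:
  fixes \<alpha> \<gamma> :: "nat \<Rightarrow> real"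
  assumes lb: "\<And>H h. \<lbrakk>\<And>i. i \<in> {1..d} \<Longrightarrow> \<bar>h i\<bar> \<le> int H; \<exists>i\<in>{1..d}. h i \<noteq> 0\<rbrakk>
       \<Longrightarrow> 1 \<le> real B * real H ^ \<tau> * dist_int (\<Sum>i=1..d. of_int (h i) * \<alpha> i)"
    and B: "B \<ge> 1"
    and J: "J \<ge> 1" "64 * real L * (real J + 1) \<le> 2 ^ J" "2 ^ (d + 6) * real B \<le> 2 ^ J"
    and L: "L = d + 2 * \<tau> + 2" and t: "J = t div L"
  defines "W \<equiv> bohr_weight d \<alpha> \<gamma> J"
  shows "(\<Sum>n\<in>{2^t<..2^(t+1)}. W n) \<le> 2 * (2 ^ t * real J ^ d)"
    and "(\<Sum>n\<in>{2^t<..2^(t+1)}. W n * real (card (totatives n)) / real n) \<ge> 2 ^ t * real J ^ d / 8"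
    and "(2 * 2 ^ J) ^ d \<le> (2::real) ^ t"
proof -
  define N :: nat where "N = 2 ^ t"
  define K :: nat where "K = 2 ^ J"
  define X where "X = real N * real J ^ d"
  define E where "E = (2 * real K) ^ d * (real B * (real K * real K) ^ \<tau>)"
  define M where "M = (\<lambda>q. \<Sum>n\<in>{n\<in>{N<..2*N}. q dvd n}. W n)"
  have W0: "W n \<ge> 0" for n unfolding W_def by (rule bohr_weight_nonneg)
  have J1: "1 \<le> real J ^ d" using J(1) by simp
  have realK: "real K = 2 ^ J" "real N = 2 ^ t" by (auto simp: K_def N_def)
  have K64: "K \<ge> 64"
  proof -
    have "1 * (64 * 1) \<le> 2 ^ d * (64 * real B)" using B by (intro mult_mono) auto
    also have "\<dots> \<le> real K" using J(3) by (simp add: realK power_add)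
    finally show ?thesis by simp
  qed
  have JL: "J * L \<le> t" "t < L * (J + 1)"
    using div_times_less_eq_dividend[of t L] dividend_less_times_div[of L t] by (simp_all add: t L)
  have KN: "real K ^ L \<le> real N"
    unfolding realK power_mult[symmetric] by (rule power_increasing) (use JL in auto)
  have Kpow: "real K ^ i \<le> real K ^ j" if "i \<le> j" for i j :: nat
    using that K64 by (intro power_increasing) auto
  have KN2: "real K * 32 \<le> real N"
  proof -
    have "real K * 32 \<le> real K ^ 2" using K64 by (simp add: power2_eq_square)
    also have "\<dots> \<le> real K ^ L" by (rule Kpow) (simp add: L)
    finally show ?thesis using KN by linarith
  qed
  have EK: "2 * real K * E \<le> real N / 32"
  proof -
    have "64 * real K * E = (2 ^ (d + 6) * real B) * real K ^ (d + 2 * \<tau> + 1)"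
      by (simp add: E_def power_mult_distrib power_add power_mult power2_eq_square mult_ac)
    also have "\<dots> \<le> real K * real K ^ (d + 2 * \<tau> + 1)"
      using J(3) by (intro mult_right_mono) (auto simp: realK)
    also have "\<dots> = real K ^ L" by (simp add: L)
    finally have "64 * real K * E \<le> real N" using KN by linarith
    then show ?thesis by simp
  qed
  have E0: "E \<ge> 0" by (simp add: E_def)
  have XN: "real N \<le> X" using mult_left_mono[OF J1, of "real N"] by (simp add: X_def)
  have EX: "E \<le> X / 32"
  proof -
    have "1 * E \<le> 2 * real K * E" using K64 E0 by (intro mult_right_mono) auto
    then show ?thesis using EK XN by linarith
  qed
  have block: "{2^t<..2^(t+1)} = {N<..2*N}" by (simp add: N_def)
  have "{n\<in>{N<..2*N}. 1 dvd n} = {N<..2*N}" by auto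
  then have M1: "(\<Sum>n\<in>{N<..2*N}. W n) = M 1" by (simp only: M_def)
  have M1_bound: "\<bar>M 1 - X\<bar> \<le> E"
    using sum_bohr_weight_block[where q = 1 and J = J and N = N and \<gamma> = \<gamma>, OF lb] unfolding M_def W_def X_def E_def by (simp add: realK)
  have Mq: "M q \<le> (real N / real q + 1) * real J ^ d + E" if q: "q \<in> {2..K}" for q
  proof -
    have "M q \<le> real (2 * N div q - N div q) * real J ^ d + E"
      using sum_bohr_weight_block[where q = q and J = J and N = N and \<gamma> = \<gamma>, OF lb] q unfolding M_def W_def E_def realK by (simp add: K_def)
    moreover have "real (2 * N div q - N div q) \<le> real N / real q + 1"
    proof -
      have "real (2 * N div q) \<le> real (2 * N) / real q" by (rule of_nat_div_le_of_nat)
      moreover have "real N / real q \<le> real (N div q) + 1"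
      proof -
        have "N < (N div q + 1) * q" using q dividend_less_div_times[of q N] by simp
        then have "real N < real ((N div q + 1) * q)" by (simp only: of_nat_less_iff)
        then show ?thesis using q by (simp add: field_simps)
      qed
      moreover have "N div q \<le> 2 * N div q" by (rule div_le_mono) simp
      ultimately show ?thesis by (simp add: of_nat_diff)
    qed
    then have "real (2 * N div q - N div q) * real J ^ d \<le> (real N / real q + 1) * real J ^ d"
      by (intro mult_right_mono) auto
    ultimately show ?thesis by linarith
  qed
  show "(\<Sum>n\<in>{2^t<..2^(t+1)}. W n) \<le> 2 * (2 ^ t * real J ^ d)"
    unfolding block M1 using M1_bound EX XN by (simp add: X_def realK)
  have "1 * (2 * real K) ^ d \<le> 2 ^ d * real K ^ d" by (simp add: power_mult_distrib)
  also have "\<dots> \<le> real K * real K ^ d"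
  proof (intro mult_right_mono)
    have "2 ^ d * 1 \<le> 2 ^ d * (64 * real B)" using B by (intro mult_left_mono) auto
    moreover have "2 ^ d * (64 * real B) \<le> real K" using J(3) by (simp add: realK power_add mult_ac)
    ultimately show "2 ^ d \<le> real K" by linarith
  qed simp
  also have "\<dots> = real K ^ (d + 1)" by simp
  also have "\<dots> \<le> real K ^ L" by (rule Kpow) (simp add: L)
  finally show "(2 * 2 ^ J) ^ d \<le> (2::real) ^ t" using KN unfolding realK by linarith
  define \<epsilon> where "\<epsilon> = (real t + 1) / real K"
  have eps: "\<epsilon> \<le> 1 / 64"
  proof -
    have "t + 1 \<le> L * (J + 1)" using JL by simp
    then have "real (t + 1) \<le> real (L * (J + 1))" by (simp only: of_nat_le_iff)
    then have "64 * (real t + 1) \<le> 64 * (real L * (real J + 1))" by (simp add: algebra_simps)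
    then have "64 * (real t + 1) \<le> real K" using J(2) unfolding realK by linarith
    then show ?thesis using K64 by (simp add: \<epsilon>_def field_simps)
  qed
  have "(\<Sum>n\<in>{N<..2*N}. W n * real (card (totatives n)) / real n)
     \<ge> (\<Sum>n\<in>{N<..2*N}. W n * (1 - (\<Sum>q\<in>{q\<in>{2..K}. q dvd n}. 1 / real q) - \<epsilon>))"
  proof (rule sum_mono)
    fix n assume n: "n \<in> {N<..2*N}"
    have "W n * (1 - (\<Sum>q\<in>{q\<in>{2..K}. q dvd n}. 1 / real q) - \<epsilon>) \<le> W n * (real (card (totatives n)) / real n)"
      unfolding \<epsilon>_def using n K64 by (intro mult_left_mono totient_density_ge W0) (auto simp: N_def)
    then show "W n * (1 - (\<Sum>q\<in>{q\<in>{2..K}. q dvd n}. 1 / real q) - \<epsilon>) \<le> W n * real (card (totatives n)) / real n"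
      by simp
  qed
  moreover have "(\<Sum>n\<in>{N<..2*N}. W n * (1 - (\<Sum>q\<in>{q\<in>{2..K}. q dvd n}. 1 / real q) - \<epsilon>))
     = (1 - \<epsilon>) * M 1 - (\<Sum>q=2..K. M q / real q)"
  proof -
    have "(\<Sum>n\<in>{N<..2*N}. W n * (\<Sum>q\<in>{q\<in>{2..K}. q dvd n}. 1 / real q))
       = (\<Sum>n\<in>{N<..2*N}. \<Sum>q=2..K. if q dvd n then W n / real q else 0)"
    proof (rule sum.cong[OF refl])
      fix n
      have "(\<Sum>q\<in>{q\<in>{2..K}. q dvd n}. W n / real q) = (\<Sum>q=2..K. if q dvd n then W n / real q else 0)"
        by (rule sum.inter_filter) simp
      then show "W n * (\<Sum>q\<in>{q\<in>{2..K}. q dvd n}. 1 / real q) = (\<Sum>q=2..K. if q dvd n then W n / real q else 0)"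
        by (simp add: sum_distrib_left)
    qed
    also have "\<dots> = (\<Sum>q=2..K. \<Sum>n\<in>{N<..2*N}. if q dvd n then W n / real q else 0)" by (rule sum.swap)
    also have "\<dots> = (\<Sum>q=2..K. M q / real q)"
    proof (rule sum.cong[OF refl])
      fix q
      have "(\<Sum>n\<in>{n\<in>{N<..2*N}. q dvd n}. W n / real q) = (\<Sum>n\<in>{N<..2*N}. if q dvd n then W n / real q else 0)"
        by (rule sum.inter_filter) simp
      then show "(\<Sum>n\<in>{N<..2*N}. if q dvd n then W n / real q else 0) = M q / real q"
        by (simp add: M_def sum_divide_distrib)
    qed
    finally have *: "(\<Sum>n\<in>{N<..2*N}. W n * (\<Sum>q\<in>{q\<in>{2..K}. q dvd n}. 1 / real q)) = (\<Sum>q=2..K. M q / real q)" .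
    have "(\<Sum>n\<in>{N<..2*N}. W n * (1 - (\<Sum>q\<in>{q\<in>{2..K}. q dvd n}. 1 / real q) - \<epsilon>))
      = (\<Sum>n\<in>{N<..2*N}. (1 - \<epsilon>) * W n - W n * (\<Sum>q\<in>{q\<in>{2..K}. q dvd n}. 1 / real q))"
      by (intro sum.cong refl) (simp add: algebra_simps)
    also have "\<dots> = (1 - \<epsilon>) * M 1 - (\<Sum>q=2..K. M q / real q)"
      by (simp only: sum_subtractf sum_distrib_left[symmetric] * M1)
    finally show ?thesis .
  qed
  moreover have "(\<Sum>q=2..K. M q / real q) \<le> 3 / 4 * X + real K * real J ^ d + real K * E"
  proof -
    have "(\<Sum>q=2..K. M q / real q) \<le> (\<Sum>q=2..K. X * (1 / (real q)\<^sup>2) + (real J ^ d + E))"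
    proof (rule sum_mono)
      fix q assume q: "q \<in> {2..K}"
      have "M q / real q \<le> ((real N / real q + 1) * real J ^ d + E) / real q"
        using Mq[OF q] by (rule divide_right_mono) simp
      also have "\<dots> = X * (1 / (real q)\<^sup>2) + (real J ^ d + E) / real q"
        using q by (simp add: X_def power2_eq_square field_simps)
      also have "(real J ^ d + E) / real q \<le> (real J ^ d + E) / 1"
        using q E0 by (intro divide_left_mono) auto
      finally show "M q / real q \<le> X * (1 / (real q)\<^sup>2) + (real J ^ d + E)" by simp
    qed
    also have "\<dots> = X * (\<Sum>q=2..K. 1 / (real q)\<^sup>2) + real (card {2..K}) * (real J ^ d + E)"
      by (simp add: sum.distrib sum_distrib_left)
    also have "\<dots> \<le> X * (3 / 4) + real K * (real J ^ d + E)"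
    proof (intro add_mono mult_left_mono mult_right_mono)
      have "0 \<le> 1 / real K" by simp
      then show "(\<Sum>q=2..K. 1 / (real q)\<^sup>2) \<le> 3 / 4" using sum_inverse_squares_le[of K] K64 by linarith
    qed (use E0 in \<open>auto simp: X_def\<close>)
    finally show ?thesis by (simp add: algebra_simps)
  qed
  moreover have "real K * real J ^ d \<le> X / 32"
  proof -
    have "real K * 32 * real J ^ d \<le> real N * real J ^ d" by (intro mult_right_mono KN2) simp
    then show ?thesis by (simp add: X_def)
  qed
  moreover have "real K * E \<le> X / 64" using EK XN by linarith
  moreover have "(1 - \<epsilon>) * M 1 \<ge> X - E - X / 32"
  proof -
    have "M 1 \<le> 2 * X" using M1_bound EX XN by (simp add: abs_le_iff) 
    moreover have "M 1 \<ge> 0" unfolding M_def by (intro sum_nonneg W0)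
    ultimately have "\<epsilon> * M 1 \<le> 1 / 64 * (2 * X)" using eps by (intro mult_mono) auto
    then show ?thesis using M1_bound by (simp add: algebra_simps abs_le_iff)
  qed
  ultimately have "(\<Sum>n\<in>{N<..2*N}. W n * real (card (totatives n)) / real n) \<ge> X / 8"
    using EX XN by linarith
  then show "(\<Sum>n\<in>{2^t<..2^(t+1)}. W n * real (card (totatives n)) / real n) \<ge> 2 ^ t * real J ^ d / 8"
    unfolding block by (simp add: X_def realK)
qed

section \<open>Overlaps of intervals around reduced fractions\<close>

lemma card_int_abs_less:
  fixes X :: real
  shows "finite {u::int. u \<noteq> 0 \<and> \<bar>real_of_int u\<bar> < X}" (is ?fin)
    and "X \<ge> 0 \<Longrightarrow> real (card {u::int. u \<noteq> 0 \<and> \<bar>real_of_int u\<bar> < X}) \<le> 2 * X"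
proof -
  have sub: "{u::int. u \<noteq> 0 \<and> \<bar>real_of_int u\<bar> < X} \<subseteq> {-\<lfloor>X\<rfloor>..\<lfloor>X\<rfloor>} - {0}"
    by (auto simp: le_floor_iff) linarith+
  show ?fin by (rule finite_subset[OF sub]) auto
  assume X: "X \<ge> 0"
  have "card {u::int. u \<noteq> 0 \<and> \<bar>real_of_int u\<bar> < X} \<le> card ({-\<lfloor>X\<rfloor>..\<lfloor>X\<rfloor>} - {0})"
    by (rule card_mono[OF _ sub]) auto
  also have "\<dots> = nat (2 * \<lfloor>X\<rfloor>)" using X by (subst card_Diff_subset) auto
  finally have "real (card {u::int. u \<noteq> 0 \<and> \<bar>real_of_int u\<bar> < X}) \<le> real (nat (2 * \<lfloor>X\<rfloor>))"
    by (simp only: of_nat_le_iff)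
  also have "\<dots> \<le> 2 * X" using X by simp
  finally show "real (card {u::int. u \<noteq> 0 \<and> \<bar>real_of_int u\<bar> < X}) \<le> 2 * X" .
qed

text \<open>
  Let \<open>g\<close> be the greatest common divisor of \<open>m\<close> and \<open>n\<close>. The differences \<open>a * n - b * m\<close> are multiples of \<open>g\<close>, so only
  \<open>2 * V / g\<close> nonzero values are possible, and each of them determines \<open>a\<close> modulo \<open>m / g\<close>, hence is attained at
  most \<open>g\<close> times. The two factors \<open>g\<close> cancel; excluding the value 0 is essential for this.
\<close>

lemma card_close_fractions_le:
  fixes m n :: nat and V :: real
  assumes "m > 0" "n > 0" "V \<ge> 0"
  shows "real (card {(a, b). a \<in> {1..m} \<and> b \<in> {1..n} \<and> a * n \<noteq> b * m \<and>
           \<bar>real (a * n) - real (b * m)\<bar> < V}) \<le> 2 * V"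
proof -
  define S where "S = {(a, b). a \<in> {1..m} \<and> b \<in> {1..n} \<and> a * n \<noteq> b * m \<and>
           \<bar>real (a * n) - real (b * m)\<bar> < V}"
  define g where "g = gcd m n"
  have "g \<noteq> 0" using assms(1) by (simp add: g_def)
  then obtain m' n' where mn': "m = m' * g" "n = n' * g" "coprime m' n'"
    using gcd_coprime_exists[of m n] unfolding g_def by blast
  then have mn: "m = g * m'" "n = g * n'" "coprime m' n'" by (simp_all only: mult.commute)
  have pos: "g > 0" "m' > 0" "n' > 0" using assms mn by auto
  define U where "U = {u::int. u \<noteq> 0 \<and> \<bar>real_of_int u\<bar> < V / real g}"
  \<comment> \<open>The second component tells apart the at most \<open>g\<close> numbers \<open>a\<close> in \<open>{1..m}\<close> that are congruent modulo \<open>m'\<close>.\<close>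
  define f where "f = (\<lambda>(a::nat, b::nat). (int (a * n') - int (b * m'), (a - 1) div m'))"
  have fS: "f ` S \<subseteq> U \<times> {..<g}"
  proof
    fix p assume "p \<in> f ` S"
    then obtain a b where ab: "(a, b) \<in> S" "p = f (a, b)" by auto
    have a: "1 \<le> a" "a \<le> g * m'" using ab by (auto simp: S_def mn)
    have "(a - 1) div m' < g" by (rule less_mult_imp_div_less) (use a in linarith)
    moreover have "int (a * n') - int (b * m') \<in> U"
    proof -
      have "real (a * n) - real (b * m) = real g * (real (a * n') - real (b * m'))"
        by (simp add: mn algebra_simps)
      then have "real g * \<bar>real (a * n') - real (b * m')\<bar> < V"
        using ab by (auto simp: S_def abs_mult)
      then have "\<bar>real (a * n') - real (b * m')\<bar> < V / real g" using pos by (simp add: field_simps)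
      moreover have "a * n' \<noteq> b * m'" using ab by (auto simp: S_def mn)
      then have "int (a * n') - int (b * m') \<noteq> 0" by (simp only: right_minus_eq of_nat_eq_iff not_False_eq_True)
      ultimately show ?thesis unfolding U_def by simp
    qed
    ultimately show "p \<in> U \<times> {..<g}" by (simp add: ab f_def)
  qed
  have inj: "inj_on f S"
  proof (rule inj_onI)
    fix p q assume pq: "p \<in> S" "q \<in> S" "f p = f q"
    obtain a b where p: "p = (a, b)" by (cases p)
    obtain c e where q: "q = (c, e)" by (cases q)
    have ac: "a \<ge> 1" "c \<ge> 1" using pq by (auto simp: p q S_def)
    have eq: "int (a * n') - int (b * m') = int (c * n') - int (e * m')"
      and dv: "(a - 1) div m' = (c - 1) div m'"
      using pq by (auto simp: p q f_def)
    have "(int a - int c) * int n' = int m' * (int b - int e)" using eq by (simp add: algebra_simps)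
    then have "int m' dvd (int a - int c) * int n'" by simp
    then have "int m' dvd int a - int c" using mn(3) by (simp add: coprime_dvd_mult_left_iff)
    then have "int m' dvd int (a - 1) - int (c - 1)" using ac by (simp add: of_nat_diff)
    then have "int (a - 1) mod int m' = int (c - 1) mod int m'" by (simp only: mod_eq_dvd_iff)
    then have "(a - 1) mod m' = (c - 1) mod m'" by (simp only: zmod_int[symmetric] of_nat_eq_iff)
    then have "a - 1 = c - 1" using dv by (metis div_mult_mod_eq)
    then have "a = c" using ac by simp
    moreover from this eq have "b = e" using pos by simp
    ultimately show "p = q" by (simp add: p q)
  qed
  have "card S = card (f ` S)" by (simp add: card_image inj)
  also have "\<dots> \<le> card (U \<times> {..<g})"
    by (rule card_mono[OF _ fS]) (auto simp: U_def card_int_abs_less(1))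
  also have "\<dots> = card U * g" by (simp add: card_cartesian_product)
  finally have "real (card S) \<le> real (card U * g)" by (simp only: of_nat_le_iff)
  also have "\<dots> = real (card U) * real g" by simp
  also have "\<dots> \<le> (2 * (V / real g)) * real g"
    unfolding U_def using assms pos by (intro mult_right_mono card_int_abs_less(2)) auto
  finally show ?thesis using pos by (simp add: S_def)
qed

definition frac_interval :: "(nat \<Rightarrow> real) \<Rightarrow> nat \<times> nat \<Rightarrow> real set" where
  "frac_interval \<Psi> p = (case p of (n, a) \<Rightarrow> {x. \<bar>x - real a / real n\<bar> < \<Psi> n / real n})"

lemma frac_interval_eq:
  "frac_interval \<Psi> (n, a) = {real a / real n - \<Psi> n / real n <..< real a / real n + \<Psi> n / real n}"
  by (auto simp: frac_interval_def abs_less_iff)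

lemma frac_interval_lmeasurable [simp]: "frac_interval \<Psi> p \<in> lmeasurable"
  by (cases p) (simp add: frac_interval_eq)

lemma measure_frac_interval: "\<Psi> n \<ge> 0 \<Longrightarrow> measure lebesgue (frac_interval \<Psi> (n, a)) = 2 * \<Psi> n / real n"
  by (simp add: frac_interval_eq)

text \<open>
  Two intervals of radii \<open>r\<close> and \<open>s\<close> meet only if their centres are closer than \<open>2 * max r s\<close>, and then overlap in
  length at most \<open>2 * min r s\<close>. The number of such pairs is at most \<open>4 * max r s * m * n\<close>, and
  \<open>min r s * max r s = r * s\<close>.
\<close>

lemma sum_measure_overlap_le:
  fixes \<Psi> :: "nat \<Rightarrow> real"
  assumes "m > 0" "n > 0" and nonneg: "\<Psi> m \<ge> 0" "\<Psi> n \<ge> 0"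
  shows "(\<Sum>(a, b)\<in>{(a, b). a \<in> {1..m} \<and> b \<in> {1..n} \<and> a * n \<noteq> b * m}.
            measure lebesgue (frac_interval \<Psi> (m, a) \<inter> frac_interval \<Psi> (n, b)))
         \<le> 8 * \<Psi> m * \<Psi> n"
proof -
  define r s where "r = \<Psi> m / real m" and "s = \<Psi> n / real n"
  have rs: "r \<ge> 0" "s \<ge> 0" using nonneg by (auto simp: r_def s_def)
  define P where "P = {(a, b). a \<in> {1..m} \<and> b \<in> {1..n} \<and> a * n \<noteq> b * m}"
  define V where "V = 2 * max r s * real m * real n"
  define Q where "Q = {(a, b). a \<in> {1..m} \<and> b \<in> {1..n} \<and> a * n \<noteq> b * m \<and>
           \<bar>real (a * n) - real (b * m)\<bar> < V}"
  let ?I = "\<lambda>(a, b). measure lebesgue (frac_interval \<Psi> (m, a) \<inter> frac_interval \<Psi> (n, b))"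
  have finP: "finite P" unfolding P_def
    by (rule finite_subset[of _ "{1..m} \<times> {1..n}"]) auto
  have QP: "Q \<subseteq> P" by (auto simp: Q_def P_def)
  have "sum ?I P = sum ?I Q"
  proof (rule sum.mono_neutral_right[OF finP QP], rule ballI)
    fix p assume p: "p \<in> P - Q"
    obtain a b where ab: "p = (a, b)" by (cases p)
    have far: "V \<le> \<bar>real (a * n) - real (b * m)\<bar>" using p by (auto simp: ab P_def Q_def)
    have "frac_interval \<Psi> (m, a) \<inter> frac_interval \<Psi> (n, b) = {}"
    proof (rule ccontr)
      assume "\<not> ?thesis"
      then obtain x where x: "\<bar>x - real a / real m\<bar> < r" "\<bar>x - real b / real n\<bar> < s"
        by (auto simp: frac_interval_def r_def s_def)
      then have "\<bar>real a / real m - real b / real n\<bar> < 2 * max r s" by linarith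
      then have "\<bar>real a / real m - real b / real n\<bar> * (real m * real n) < 2 * max r s * (real m * real n)"
        using assms by (intro mult_strict_right_mono) auto
      moreover have "\<bar>real a / real m - real b / real n\<bar> * (real m * real n) = \<bar>real (a * n) - real (b * m)\<bar>"
      proof -
        have "(real a / real m - real b / real n) * (real m * real n) = real (a * n) - real (b * m)"
          using assms by (simp add: field_simps)
        then show ?thesis by (metis abs_mult abs_of_nonneg mult_nonneg_nonneg of_nat_0_le_iff)
      qed
      ultimately show False using far by (simp add: V_def mult_ac)
    qed
    then show "?I p = 0" by (simp add: ab)
  qed
  also have "\<dots> \<le> (\<Sum>p\<in>Q. 2 * min r s)"
  proof (rule sum_mono)
    fix p assume "p \<in> Q"
    obtain a b where ab: "p = (a, b)" by (cases p)
    have "?I p \<le> measure lebesgue (frac_interval \<Psi> (m, a))" "?I p \<le> measure lebesgue (frac_interval \<Psi> (n, b))"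
      unfolding ab prod.case
      by (intro measure_mono_fmeasurable fmeasurableD fmeasurable.Int frac_interval_lmeasurable; blast)+
    then show "?I p \<le> 2 * min r s"
      by (simp add: measure_frac_interval nonneg r_def s_def min_def)
  qed
  also have "\<dots> = real (card Q) * (2 * min r s)" by simp
  also have "\<dots> \<le> (2 * V) * (2 * min r s)"
    unfolding Q_def by (intro mult_right_mono card_close_fractions_le) (use assms rs in \<open>auto simp: V_def\<close>)
  also have "\<dots> = 8 * (min r s * max r s) * (real m * real n)" by (simp add: V_def)
  also have "min r s * max r s = r * s" by (simp add: min_def max_def)
  also have "8 * (r * s) * (real m * real n) = 8 * \<Psi> m * \<Psi> n" using assms by (simp add: r_def s_def)
  finally show ?thesis unfolding P_def .
qed

section \<open>A Borel--Cantelli argument without independence\<close>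

text \<open>
  If \<open>Z T\<close> were bounded in \<open>T\<close> almost everywhere, then off a set \<open>X R\<close> of very small measure the bound would be a
  constant \<open>R\<close>. On \<open>X R\<close> the inequality \<open>Z \<le> \<delta> / S * Z\<^sup>2 + S / (4 * \<delta>)\<close> and the second moment show that the
  integral over \<open>X R\<close> is at most half of \<open>c * S\<close>, so that \<open>c * S T\<close> stays bounded in \<open>T\<close>.
\<close>

lemma (in finite_measure) not_AE_bounded_of_second_moment:
  fixes Z :: "nat \<Rightarrow> 'a \<Rightarrow> real" and S :: "nat \<Rightarrow> real"
  assumes int: "\<And>T. integrable M (Z T)" and int2: "\<And>T. integrable M (\<lambda>x. (Z T x)\<^sup>2)"
    and lower: "\<And>T. c * S T \<le> (\<integral>x. Z T x \<partial>M)"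
    and upper: "\<And>T. S T \<ge> 1 \<Longrightarrow> (\<integral>x. (Z T x)\<^sup>2 \<partial>M) \<le> C * (S T)\<^sup>2"
    and c: "c > 0" and C: "C > 0"
    and lim: "filterlim S at_top sequentially"
  shows "\<not> (AE x in M. \<exists>R. \<forall>T. Z T x \<le> R)"
proof
  assume ae: "AE x in M. \<exists>R. \<forall>T. Z T x \<le> R"
  have [measurable]: "Z T \<in> borel_measurable M" for T using int by auto
  define X where "X = (\<lambda>R::nat. {x\<in>space M. \<not> (\<forall>T. Z T x \<le> real R)})"
  have X [measurable]: "X R \<in> sets M" for R unfolding X_def by measurable
  have "(\<lambda>R. measure M (X R)) \<longlonglongrightarrow> measure M (\<Inter>R. X R)"
  proof (rule finite_Lim_measure_decseq)
    show "range X \<subseteq> sets M" using X by auto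
    show "decseq X"
      unfolding decseq_def
    proof (intro allI impI subsetI)
      fix m n x assume "m \<le> n" "x \<in> X n"
      moreover from this obtain T where "\<not> Z T x \<le> real n" by (auto simp: X_def)
      ultimately have "x \<in> space M" "\<not> Z T x \<le> real m" by (auto simp: X_def)
      then show "x \<in> X m" unfolding X_def by blast
    qed
  qed
  also have "measure M (\<Inter>R. X R) = 0"
  proof -
    have "AE x in M. x \<notin> (\<Inter>R. X R)"
      using ae
    proof eventually_elim
      case (elim x)
      then obtain r where r: "\<And>T. Z T x \<le> r" by blast
      obtain R :: nat where "r \<le> real R" using real_arch_simple by blast
      then have "\<forall>T. Z T x \<le> real R" using r order.trans by blast
      then have "x \<notin> X R" unfolding X_def by blast
      then show ?case by blast
    qed
    moreover have "(\<Inter>R. X R) \<in> sets M" by auto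
    ultimately have "(\<Inter>R. X R) \<in> null_sets M" by (simp add: AE_iff_null_sets)
    then show ?thesis by (rule measure_eq_0_null_sets)
  qed
  finally have X0: "(\<lambda>R. measure M (X R)) \<longlonglongrightarrow> 0" .
  define \<delta> where "\<delta> = c / (4 * C)"
  have \<delta>: "\<delta> > 0" using c C by (simp add: \<delta>_def)
  have "c * \<delta> > 0" using c \<delta> by simp
  then have "\<forall>\<^sub>F R in sequentially. measure M (X R) < c * \<delta>" using X0 by (rule order_tendstoD(2)[rotated])
  then obtain R where R: "measure M (X R) < c * \<delta>" by (auto simp: eventually_sequentially)
  have bound: "c * S T \<le> 2 * (real R * measure M (space M))" if s: "S T \<ge> 1" for T
  proof -
    have "Z T x \<le> real R + (\<delta> / S T) * (Z T x)\<^sup>2 + (S T / (4 * \<delta>)) * indicator (X R) x" if x: "x \<in> space M" for x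
    proof (cases "x \<in> X R")
      case True
      have "0 \<le> (\<delta> / S T) * (Z T x - S T / (2 * \<delta>))\<^sup>2" using s \<delta> by simp
      also have "\<dots> = (\<delta> / S T) * (Z T x)\<^sup>2 - Z T x + S T / (4 * \<delta>)"
        using s \<delta> by (simp add: power2_eq_square field_simps)
      finally show ?thesis using True by simp
    next
      case False
      then have "Z T x \<le> real R" using x by (auto simp: X_def)
      moreover have "0 \<le> (\<delta> / S T) * (Z T x)\<^sup>2" using s \<delta> by simp
      ultimately show ?thesis using False by simp
    qed
    moreover have intX: "integrable M (indicat_real (X R))"
      by (rule integrable_real_indicator) (auto simp: emeasure_eq_measure)
    ultimately have "(\<integral>x. Z T x \<partial>M) \<le> (\<integral>x. real R + (\<delta> / S T) * (Z T x)\<^sup>2 + (S T / (4 * \<delta>)) * indicator (X R) x \<partial>M)"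
      by (intro integral_mono int Bochner_Integration.integrable_add integrable_mult_right int2) auto
    also have "\<dots> = real R * measure M (space M) + (\<delta> / S T) * (\<integral>x. (Z T x)\<^sup>2 \<partial>M) + (S T / (4 * \<delta>)) * measure M (X R)"
      using int2 intX by (simp add: mult.commute)
    also have "\<dots> \<le> real R * measure M (space M) + (\<delta> / S T) * (C * (S T)\<^sup>2) + (S T / (4 * \<delta>)) * (c * \<delta>)"
      using s \<delta> R upper[OF s] by (intro add_mono mult_left_mono) auto
    also have "\<dots> = real R * measure M (space M) + c * S T / 2"
      using s c C by (simp add: \<delta>_def power2_eq_square field_simps)
    finally show ?thesis using lower[of T] by linarith
  qed
  have "\<forall>\<^sub>F T in sequentially. S T \<ge> max 1 (2 * (real R * measure M (space M)) / c + 1)"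
    using lim unfolding filterlim_at_top by blast
  then obtain T where "S T \<ge> 1" "S T \<ge> 2 * (real R * measure M (space M)) / c + 1"
    by (auto simp: eventually_sequentially)
  with bound[of T] c show False by (simp add: field_simps)
qed

text \<open>
  This is why reduced fractions are used: off the diagonal of the second moment, no two centres coincide.
\<close>

lemma reduced_fractions_distinct:
  fixes a b m n :: nat
  assumes "coprime a m" "coprime b n" "a * n = b * m" "m > 0" "n > 0"
  shows "m = n" "a = b"
proof -
  have "m dvd a * n" "n dvd b * m" using assms(3) by (metis dvd_triv_right)+
  then have "m dvd n" "n dvd m" using assms(1,2)
    by (simp_all add: coprime_commute coprime_dvd_mult_right_iff)
  then show "m = n" by (rule dvd_antisym)
  then show "a = b" using assms(3,5) by simp
qed

text \<open>
  The counting function \<open>Z\<close> of the intervals around reduced fractions satisfies the hypotheses of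
  \<open>not_AE_bounded_of_second_moment\<close>: its square integrates to the diagonal \<open>O(S)\<close> plus overlaps \<open>O(S\<^sup>2)\<close>. If only
  finitely many \<open>n\<close> were good for almost every point, then \<open>Z\<close> would be bounded almost everywhere, since each \<open>n\<close>
  contributes at most \<open>n\<close> intervals.
\<close>

lemma limsup_reduced_intervals_not_null:
  fixes \<Psi> :: "nat \<Rightarrow> real" and N :: "nat \<Rightarrow> nat" and S :: "nat \<Rightarrow> real"
  assumes nonneg: "\<And>n. \<Psi> n \<ge> 0" and small: "\<And>n. n \<ge> 1 \<Longrightarrow> \<Psi> n \<le> real n"
    and c: "c > 0" and C: "C > 0"
    and lower: "\<And>T. c * S T \<le> (\<Sum>n=1..N T. \<Psi> n * real (card (totatives n)) / real n)"
    and upper: "\<And>T. (\<Sum>n=1..N T. \<Psi> n) \<le> C * S T"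
    and lim: "filterlim S at_top sequentially"
  shows "\<not> (AE x in lebesgue. finite {n. n \<ge> 1 \<and> dist_int (real n * x) < \<Psi> n})"
proof
  assume ae: "AE x in lebesgue. finite {n. n \<ge> 1 \<and> dist_int (real n * x) < \<Psi> n}"
  define M where "M = lebesgue_on {-1..2::real}"
  interpret finite_measure M
    unfolding M_def by (rule finite_measure_lebesgue_on) simp
  let ?I = "frac_interval \<Psi>"
  define A where "A = (\<lambda>T. SIGMA n:{1..N T}. totatives n)"
  have finA: "finite (A T)" for T by (auto simp: A_def)
  have AD: "n \<ge> 1 \<and> a \<ge> 1 \<and> a \<le> n \<and> coprime a n \<and> n \<le> N T" if "(n, a) \<in> A T" for n a T
    using that by (auto simp: A_def totatives_def)
  define Z where "Z = (\<lambda>T x. \<Sum>p\<in>A T. indicat_real (?I p) x)"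
  have sub: "?I p \<subseteq> {-1..2}" if p: "p \<in> A T" for p T
  proof -
    obtain n a where na: "p = (n, a)" by (cases p)
    have *: "real a / real n \<le> 1" "0 \<le> real a / real n" "\<Psi> n / real n \<le> 1"
      using AD[of n a T] p na small[of n] by auto
    show ?thesis
    proof
      fix x assume "x \<in> ?I p"
      then show "x \<in> {-1..2}"
        using * unfolding na frac_interval_eq greaterThanLessThan_iff atLeastAtMost_iff by linarith
    qed
  qed
  have msets: "?I p \<inter> ?I q \<in> sets lebesgue" for p q
    by (intro fmeasurableD fmeasurable.Int frac_interval_lmeasurable)
  have meas_M: "measure M X = measure lebesgue X" "X \<in> sets M"
    if "X \<in> sets lebesgue" "X \<subseteq> {-1..2}" for X
    using that unfolding M_def
    by (auto simp: measure_restrict_space sets_restrict_space_iff)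
  have int_ind: "integrable M (indicat_real (?I p \<inter> ?I q))"
      "(\<integral>x. indicat_real (?I p \<inter> ?I q) x \<partial>M) = measure lebesgue (?I p \<inter> ?I q)"
    if "p \<in> A T" for p q T
  proof -
    have X: "?I p \<inter> ?I q \<in> sets lebesgue" "?I p \<inter> ?I q \<subseteq> {-1..2}" using msets sub[OF that] by auto
    show "integrable M (indicat_real (?I p \<inter> ?I q))"
      using meas_M(2)[OF X] by (intro integrable_real_indicator) (auto simp: emeasure_eq_measure)
    show "(\<integral>x. indicat_real (?I p \<inter> ?I q) x \<partial>M) = measure lebesgue (?I p \<inter> ?I q)"
      using meas_M[OF X] sets.sets_into_space[OF meas_M(2)[OF X]] by (simp add: Int_absorb2)
  qed
  have Zint: "integrable M (Z T)" "(\<integral>x. Z T x \<partial>M) = (\<Sum>p\<in>A T. measure lebesgue (?I p))" for T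
  proof -
    have one: "integrable M (indicat_real (?I p))" "(\<integral>x. indicat_real (?I p) x \<partial>M) = measure lebesgue (?I p)"
      if "p \<in> A T" for p
      using int_ind[OF that, of p] by simp_all
    show "integrable M (Z T)" unfolding Z_def by (intro Bochner_Integration.integrable_sum one(1))
    have "(\<integral>x. Z T x \<partial>M) = (\<Sum>p\<in>A T. \<integral>x. indicat_real (?I p) x \<partial>M)"
      unfolding Z_def by (intro Bochner_Integration.integral_sum one(1))
    then show "(\<integral>x. Z T x \<partial>M) = (\<Sum>p\<in>A T. measure lebesgue (?I p))" using one(2) by simp
  qed
  have sum_A: "(\<Sum>p\<in>A T. f p) = (\<Sum>n=1..N T. \<Sum>a\<in>totatives n. f (n, a))" for f :: "nat \<times> nat \<Rightarrow> real" and T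
    unfolding A_def by (subst sum.Sigma) auto
  have diag: "(\<Sum>p\<in>A T. measure lebesgue (?I p)) = 2 * (\<Sum>n=1..N T. \<Psi> n * real (card (totatives n)) / real n)" for T
    unfolding sum_A by (simp add: measure_frac_interval nonneg sum_distrib_left mult_ac)
  have Zsq: "(Z T x)\<^sup>2 = (\<Sum>p\<in>A T. \<Sum>q\<in>A T. indicat_real (?I p \<inter> ?I q) x)" for T x
    unfolding Z_def power2_eq_square sum_product by (simp add: indicator_inter_arith)
  have Zint2: "integrable M (\<lambda>x. (Z T x)\<^sup>2)"
    "(\<integral>x. (Z T x)\<^sup>2 \<partial>M) = (\<Sum>p\<in>A T. \<Sum>q\<in>A T. measure lebesgue (?I p \<inter> ?I q))" for T
  proof -
    show "integrable M (\<lambda>x. (Z T x)\<^sup>2)"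
      unfolding Zsq by (intro Bochner_Integration.integrable_sum int_ind(1))
    have "(\<integral>x. (Z T x)\<^sup>2 \<partial>M) = (\<Sum>p\<in>A T. \<integral>x. (\<Sum>q\<in>A T. indicat_real (?I p \<inter> ?I q) x) \<partial>M)"
      unfolding Zsq by (intro Bochner_Integration.integral_sum Bochner_Integration.integrable_sum int_ind(1))
    also have "\<dots> = (\<Sum>p\<in>A T. \<Sum>q\<in>A T. \<integral>x. indicat_real (?I p \<inter> ?I q) x \<partial>M)"
      by (intro sum.cong refl Bochner_Integration.integral_sum int_ind(1))
    also have "\<dots> = (\<Sum>p\<in>A T. \<Sum>q\<in>A T. measure lebesgue (?I p \<inter> ?I q))"
      by (intro sum.cong refl int_ind(2))
    finally show "(\<integral>x. (Z T x)\<^sup>2 \<partial>M) = (\<Sum>p\<in>A T. \<Sum>q\<in>A T. measure lebesgue (?I p \<inter> ?I q))" .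
  qed
  have off_diagonal: "(\<Sum>a\<in>totatives m. \<Sum>b\<in>totatives n. if (m, a) = (n, b) then 0 else measure lebesgue (?I (m, a) \<inter> ?I (n, b)))
      \<le> 8 * \<Psi> m * \<Psi> n" if mn: "m > 0" "n > 0" for m n
  proof -
    let ?P = "{(a, b). a \<in> {1..m} \<and> b \<in> {1..n} \<and> a * n \<noteq> b * m}"
    let ?f = "\<lambda>(a, b). measure lebesgue (?I (m, a) \<inter> ?I (n, b))"
    have "(\<Sum>a\<in>totatives m. \<Sum>b\<in>totatives n. if (m, a) = (n, b) then 0 else measure lebesgue (?I (m, a) \<inter> ?I (n, b)))
       = (\<Sum>p\<in>totatives m \<times> totatives n. if (m, fst p) = (n, snd p) then 0 else ?f p)"
      by (subst sum.cartesian_product, rule sum.cong) auto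
    also have "\<dots> = sum ?f {p \<in> totatives m \<times> totatives n. (m, fst p) \<noteq> (n, snd p)}"
      by (rule sum.mono_neutral_cong_right) auto
    also have "\<dots> \<le> sum ?f ?P"
    proof (rule sum_mono2)
      show "finite ?P" by (rule finite_subset[of _ "{1..m} \<times> {1..n}"]) auto
      show "{p \<in> totatives m \<times> totatives n. (m, fst p) \<noteq> (n, snd p)} \<subseteq> ?P"
      proof
        fix p assume p: "p \<in> {p \<in> totatives m \<times> totatives n. (m, fst p) \<noteq> (n, snd p)}"
        obtain a b where ab: "p = (a, b)" by (cases p)
        have "a * n \<noteq> b * m"
        proof
          assume "a * n = b * m"
          then have "m = n" "a = b"
            using reduced_fractions_distinct[of a m b n] p mn by (auto simp: ab totatives_def)
          then show False using p by (simp add: ab)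
        qed
        then show "p \<in> ?P" using p by (auto simp: ab totatives_def)
      qed
    qed auto
    also have "\<dots> \<le> 8 * \<Psi> m * \<Psi> n" using sum_measure_overlap_le[of m n \<Psi>] mn nonneg by simp
    finally show ?thesis .
  qed
  have "\<not> (AE x in M. \<exists>R. \<forall>T. Z T x \<le> R)"
  proof (rule not_AE_bounded_of_second_moment[where S = S and c = "2 * c" and C = "2 * C + 8 * C\<^sup>2", OF Zint(1) Zint2(1)])
    show "2 * c * S T \<le> (\<integral>x. Z T x \<partial>M)" for T
      using lower[of T] by (simp add: Zint(2) diag)
    fix T assume S1: "S T \<ge> 1"
    have "(\<Sum>p\<in>A T. \<Sum>q\<in>A T. measure lebesgue (?I p \<inter> ?I q))
       = (\<Sum>p\<in>A T. \<Sum>q\<in>A T. (if p = q then measure lebesgue (?I p) else 0) + (if p = q then 0 else measure lebesgue (?I p \<inter> ?I q)))"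
      by (intro sum.cong refl) auto
    also have "\<dots> = (\<Sum>p\<in>A T. measure lebesgue (?I p)) + (\<Sum>p\<in>A T. \<Sum>q\<in>A T. if p = q then 0 else measure lebesgue (?I p \<inter> ?I q))"
      using finA[of T] by (simp add: sum.distrib)
    also have "(\<Sum>p\<in>A T. measure lebesgue (?I p)) \<le> 2 * (C * S T)"
    proof -
      have "\<Psi> n * real (card (totatives n)) / real n \<le> \<Psi> n" for n
      proof (cases "n = 0")
        case False
        have "card (totatives n) \<le> card {1..n}" by (rule card_mono) (auto simp: totatives_def)
        then have "\<Psi> n * real (card (totatives n)) \<le> \<Psi> n * real n" by (intro mult_left_mono nonneg) simp
        then show ?thesis using False by (simp add: field_simps)
      qed (simp add: nonneg)
      then have "(\<Sum>n=1..N T. \<Psi> n * real (card (totatives n)) / real n) \<le> (\<Sum>n=1..N T. \<Psi> n)" by (rule sum_mono)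
      then show ?thesis using upper[of T] unfolding diag by linarith
    qed
    also have "(\<Sum>p\<in>A T. \<Sum>q\<in>A T. if p = q then 0 else measure lebesgue (?I p \<inter> ?I q)) \<le> 8 * (C * S T)\<^sup>2"
    proof -
      have "(\<Sum>p\<in>A T. \<Sum>q\<in>A T. if p = q then 0 else measure lebesgue (?I p \<inter> ?I q))
        = (\<Sum>m=1..N T. \<Sum>a\<in>totatives m. \<Sum>n=1..N T. \<Sum>b\<in>totatives n. if (m, a) = (n, b) then 0 else measure lebesgue (?I (m, a) \<inter> ?I (n, b)))"
        unfolding sum_A ..
      also have "\<dots> = (\<Sum>m=1..N T. \<Sum>n=1..N T. \<Sum>a\<in>totatives m. \<Sum>b\<in>totatives n. if (m, a) = (n, b) then 0 else measure lebesgue (?I (m, a) \<inter> ?I (n, b)))"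
        by (rule sum.cong[OF refl], rule sum.swap)
      also have "\<dots> \<le> (\<Sum>m=1..N T. \<Sum>n=1..N T. 8 * \<Psi> m * \<Psi> n)"
        by (intro sum_mono off_diagonal) auto
      also have "\<dots> = 8 * (\<Sum>n=1..N T. \<Psi> n)\<^sup>2"
        unfolding power2_eq_square sum_product by (simp add: sum_distrib_left mult_ac)
      also have "\<dots> \<le> 8 * (C * S T)\<^sup>2"
        using upper[of T] nonneg by (intro mult_left_mono power_mono sum_nonneg) auto
      finally show ?thesis .
    qed
    finally have "(\<integral>x. (Z T x)\<^sup>2 \<partial>M) \<le> 2 * (C * S T) + 8 * (C * S T)\<^sup>2" by (simp add: Zint2(2))
    also have "\<dots> \<le> 2 * (C * (S T)\<^sup>2) + 8 * (C * S T)\<^sup>2"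
      using S1 C by (simp add: power2_eq_square)
    finally show "(\<integral>x. (Z T x)\<^sup>2 \<partial>M) \<le> (2 * C + 8 * C\<^sup>2) * (S T)\<^sup>2"
      by (simp add: power_mult_distrib algebra_simps)
  qed (use c C lim in \<open>auto intro: add_pos_pos\<close>)
  moreover have "AE x in M. \<exists>R. \<forall>T. Z T x \<le> R"
  proof -
    have "AE x in lebesgue. \<exists>R. \<forall>T. Z T x \<le> R"
      using ae
    proof eventually_elim
      case (elim x)
      define Fx where "Fx = {n. n \<ge> 1 \<and> dist_int (real n * x) < \<Psi> n}"
      have finF: "finite Fx" using elim by (simp add: Fx_def)
      have "Z T x \<le> real (card (SIGMA n:Fx. {1..n}))" for T
      proof -
        have "Z T x = real (card {p \<in> A T. x \<in> ?I p})"
          using finA[of T] by (simp add: Z_def indicator_def sum.If_cases Int_def)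
        also have "\<dots> \<le> real (card (SIGMA n:Fx. {1..n}))"
        proof (intro of_nat_mono card_mono)
          show "finite (SIGMA n:Fx. {1..n})" using finF by auto
          show "{p \<in> A T. x \<in> ?I p} \<subseteq> (SIGMA n:Fx. {1..n})"
          proof
            fix p assume p: "p \<in> {p \<in> A T. x \<in> ?I p}"
            obtain n a where na: "p = (n, a)" by (cases p)
            have n: "n \<ge> 1" "1 \<le> a" "a \<le> n" using AD[of n a T] p na by auto
            have "\<bar>x - real a / real n\<bar> < \<Psi> n / real n" using p by (simp add: na frac_interval_def)
            then have "real n * \<bar>x - real a / real n\<bar> < \<Psi> n" using n by (simp add: field_simps)
            moreover have "real n * \<bar>x - real a / real n\<bar> = \<bar>real n * x - real a\<bar>"
            proof -
              have "real n * (x - real a / real n) = real n * x - real a" using n by (simp add: field_simps)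
              then show ?thesis by (metis abs_mult abs_of_nat)
            qed
            ultimately have "dist_int (real n * x) < \<Psi> n"
              using dist_int_le_abs_diff[of "real n * x" "int a"] by simp
            then show "p \<in> (SIGMA n:Fx. {1..n})" using n by (simp add: na Fx_def)
          qed
        qed
        finally show ?thesis .
      qed
      then show ?case by blast
    qed
    then show ?thesis unfolding M_def by (subst AE_restrict_space_iff) auto
  qed
  ultimately show False by contradiction
qed

section \<open>A zero--one law for the doubling map\<close>

lemma emeasure_unit_translate_ge:
  fixes B :: "real set"
  assumes B: "B \<in> sets lebesgue" and shift: "\<And>x z. x \<in> B \<Longrightarrow> x + of_int z \<in> B"
  shows "emeasure lebesgue (B \<inter> {0<..1}) \<le> emeasure lebesgue (B \<inter> {y..y+1})"
proof -
  define z where "z = \<lfloor>y\<rfloor>"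
  define f where "f = y - of_int z"
  have f: "0 \<le> f" "f < 1" by (auto simp: f_def z_def) linarith
  let ?S1 = "(\<lambda>x. of_int (z + 1) + 1 *\<^sub>R x) ` (B \<inter> {0<..<f})"
  let ?S2 = "(\<lambda>x. of_int z + 1 *\<^sub>R x) ` (B \<inter> {f..1})"
  have m1: "B \<inter> {0<..<f} \<in> sets lebesgue" "B \<inter> {f..1} \<in> sets lebesgue" using B by auto
  have "emeasure lebesgue (B \<inter> {0<..1}) \<le> emeasure lebesgue ((B \<inter> {0<..<f}) \<union> (B \<inter> {f..1}))"
    using m1 by (intro emeasure_mono) auto
  also have "\<dots> \<le> emeasure lebesgue (B \<inter> {0<..<f}) + emeasure lebesgue (B \<inter> {f..1})"
    using m1 by (intro emeasure_subadditive)
  also have "\<dots> = emeasure lebesgue ?S1 + emeasure lebesgue ?S2"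
    using emeasure_lebesgue_affine[of 1 "of_int (z+1)" "B \<inter> {0<..<f}"]
      emeasure_lebesgue_affine[of 1 "of_int z" "B \<inter> {f..1}"] by (simp add: add.commute)
  also have "\<dots> = emeasure lebesgue (?S1 \<union> ?S2)"
  proof (rule plus_emeasure)
    show "?S1 \<in> sets lebesgue" "?S2 \<in> sets lebesgue"
      using lebesgue_sets_translation[OF m1(1), of "of_int (z+1)"] lebesgue_sets_translation[OF m1(2), of "of_int z"]
      by simp_all
    show "?S1 \<inter> ?S2 = {}" by (auto simp: algebra_simps)
  qed
  also have "\<dots> \<le> emeasure lebesgue (B \<inter> {y..y+1})"
  proof (rule emeasure_mono)
    show "?S1 \<union> ?S2 \<subseteq> B \<inter> {y..y+1}"
      using shift[of _ "z+1"] shift[of _ z] f by (fastforce simp: f_def add.commute algebra_simps)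
  qed (use B in auto)
  finally show ?thesis .
qed

text \<open>
  A set \<open>B\<close> that contains \<open>x / 2\<close> and \<open>x + z\<close> along with \<open>x\<close> contains the copy of \<open>B\<close> shrunk by \<open>2 ^ n\<close>, which has
  period \<open>1 / 2 ^ n\<close> and the same density as \<open>B\<close> on every interval of that length.
\<close>

lemma emeasure_dyadic_interval_ge:
  fixes B :: "real set"
  assumes B: "B \<in> sets lebesgue" and shift: "\<And>x z. x \<in> B \<Longrightarrow> x + of_int z \<in> B"
    and half: "\<And>x. x \<in> B \<Longrightarrow> x / 2 \<in> B" and uv: "v - u = 1 / 2 ^ n"
  shows "emeasure lebesgue (B \<inter> {0<..1}) * emeasure lebesgue {u<..<v} \<le> emeasure lebesgue (B \<inter> {u<..<v})"
proof -
  have halfs: "x / 2 ^ n \<in> B" if "x \<in> B" for x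
    using that
  proof (induction n)
    case (Suc n)
    then show ?case using half[of "x / 2^n"] by (simp add: field_simps)
  qed auto
  have uv': "v = u + 1 / 2 ^ n" using uv by simp
  define y where "y = 2 ^ n * u"
  have null: "{u, v} \<in> null_sets lebesgue"
    using negligible_finite[of "{u, v}"] by (simp add: negligible_iff_null_sets)
  have "emeasure lebesgue (B \<inter> {0<..1}) * emeasure lebesgue {u<..<v} = ennreal (1 / 2 ^ n) * emeasure lebesgue (B \<inter> {0<..1})"
    by (simp add: uv' mult.commute)
  also have "\<dots> \<le> ennreal (1 / 2 ^ n) * emeasure lebesgue (B \<inter> {y..y+1})"
    by (intro mult_left_mono emeasure_unit_translate_ge B shift) auto
  also have "\<dots> = emeasure lebesgue ((\<lambda>x. 0 + (1 / 2 ^ n) *\<^sub>R x) ` (B \<inter> {y..y+1}))"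
    using emeasure_lebesgue_affine[of "1 / 2 ^ n" 0 "B \<inter> {y..y+1}"] by simp
  also have "\<dots> \<le> emeasure lebesgue (B \<inter> {u<..<v} \<union> {u, v})"
  proof (rule emeasure_mono)
    show "(\<lambda>x. 0 + (1 / 2 ^ n) *\<^sub>R x) ` (B \<inter> {y..y+1}) \<subseteq> B \<inter> {u<..<v} \<union> {u, v}"
    proof
      fix t assume "t \<in> (\<lambda>x. 0 + (1 / 2 ^ n) *\<^sub>R x) ` (B \<inter> {y..y+1})"
      then obtain x where x: "x \<in> B" "y \<le> x" "x \<le> y + 1" "t = x / 2 ^ n" by auto
      have "t \<in> B" using halfs x by simp
      moreover have "u \<le> t" "t \<le> v" using x by (auto simp: y_def uv' field_simps)
      ultimately show "t \<in> B \<inter> {u<..<v} \<union> {u, v}" by auto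
    qed
    show "B \<inter> {u<..<v} \<union> {u, v} \<in> sets lebesgue" using B null by (intro sets.Un sets.Int) auto
  qed
  also have "\<dots> \<le> emeasure lebesgue (B \<inter> {u<..<v}) + emeasure lebesgue {u, v}"
    using B null by (intro emeasure_subadditive sets.Int) auto
  also have "emeasure lebesgue {u, v} = 0" using null by (rule null_setsD1)
  finally show ?thesis by simp
qed

text \<open>
  Let \<open>B\<close> be the complement of \<open>E\<close> and \<open>\<beta>\<close> its density on the unit interval. By the preceding lemma \<open>B\<close> has density at least \<open>\<beta>\<close>
  on every dyadic-length interval, in particular on a cover of \<open>E \<inter> {0<..1}\<close> by such intervals. If the cover has
  excess measure at most \<open>e\<close>, then \<open>\<beta> * measure lebesgue (E \<inter> {0<..1}) \<le> e\<close>, so one of the two factors vanishes.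
\<close>

lemma zero_one_law_doubling:
  fixes E :: "real set"
  assumes E: "E \<in> sets lebesgue"
    and double: "\<And>x. x \<in> E \<Longrightarrow> 2 * x \<in> E"
    and shift: "\<And>x z. x \<in> E \<Longrightarrow> x + of_int z \<in> E"
    and pos: "E \<notin> null_sets lebesgue"
  shows "AE x in lebesgue. x \<in> E"
proof -
  let ?L = "lebesgue :: real measure"
  define B where "B = - E"
  have B: "B \<in> sets lebesgue" using sets.compl_sets[OF E] by (simp add: B_def Compl_eq_Diff_UNIV)
  have halfB: "x / 2 \<in> B" if "x \<in> B" for x using double[of "x / 2"] that by (auto simp: B_def)
  have shiftB: "x + of_int z \<in> B" if "x \<in> B" for x z
    using shift[of "x + of_int z" "-z"] that by (auto simp: B_def)
  \<comment> \<open>A translation invariant set is the union of the translates of its part in the unit interval.\<close>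
  have tile: "(\<Union>z::int. (\<lambda>x. of_int z + x) ` (A \<inter> {0<..1})) = A"
    if sh: "\<And>x z. x \<in> A \<Longrightarrow> x + of_int z \<in> A" for A :: "real set"
  proof (intro equalityI subsetI)
    fix x assume x: "x \<in> A"
    define z where "z = \<lceil>x\<rceil> - 1"
    have "x - of_int z \<in> A" using sh[OF x, of "-z"] by simp
    moreover have "0 < x - of_int z" "x - of_int z \<le> 1" by (auto simp: z_def) linarith+
    ultimately have "x \<in> (\<lambda>t. of_int z + t) ` (A \<inter> {0<..1})" by (intro image_eqI[of _ _ "x - of_int z"]) auto
    then show "x \<in> (\<Union>z::int. (\<lambda>x. of_int z + x) ` (A \<inter> {0<..1}))" by blast
  qed (use sh in \<open>auto simp: add.commute\<close>)
  have null_of_unit: "A \<in> null_sets lebesgue"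
    if "A \<inter> {0<..1} \<in> null_sets lebesgue" "\<And>x z. x \<in> A \<Longrightarrow> x + of_int z \<in> A" for A :: "real set"
  proof -
    have "(\<Union>z::int. (\<lambda>x. of_int z + x) ` (A \<inter> {0<..1})) \<in> null_sets lebesgue"
      using that(1) by (intro null_sets_UN) (simp add: negligible_iff_null_sets[symmetric] negligible_translation)
    then show ?thesis using tile[OF that(2)] by simp
  qed
  define \<beta> where "\<beta> = measure lebesgue (B \<inter> {0<..1})"
  have fm: "B \<inter> {0<..1} \<in> lmeasurable"
    using B by (intro bounded_set_imp_lmeasurable) (auto intro: bounded_subset[of "{0..1}"])
  define S where "S = E \<inter> {0<..1}"
  have S: "S \<in> lmeasurable" unfolding S_def
    using E by (intro bounded_set_imp_lmeasurable) (auto intro: bounded_subset[of "{0..1}"])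
  have Sne: "measure lebesgue S \<noteq> 0"
  proof
    assume "measure lebesgue S = 0"
    then have "S \<in> null_sets lebesgue" using S by (simp add: measure_eq_0_null_sets negligible_iff_null_sets[symmetric] negligible_iff_measure)
    then show False using null_of_unit[of E] shift pos by (simp add: S_def)
  qed
  have small: "\<beta> * measure lebesgue S \<le> e" if e: "e > 0" for e
  proof -
    have S01: "S \<subseteq> cbox 0 1" by (auto simp: S_def)
    obtain \<D> where D: "countable \<D>"
        "\<And>K. K \<in> \<D> \<Longrightarrow> K \<subseteq> cbox 0 1 \<and> K \<noteq> {} \<and> (\<exists>c d. K = cbox c (d::real))"
        "pairwise (\<lambda>A B. interior A \<inter> interior B = {}) \<D>"
        "\<And>u v. cbox u v \<in> \<D> \<Longrightarrow> \<exists>n. \<forall>i \<in> Basis. v \<bullet> i - u \<bullet> i = (1 \<bullet> i - 0 \<bullet> i)/2^n"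
        "S \<subseteq> \<Union>\<D>" "\<Union>\<D> \<in> lmeasurable" "measure lebesgue (\<Union>\<D>) \<le> measure lebesgue S + e"
      using measurable_outer_intervals_bounded[OF S S01 e] by metis
    have open_K: "\<exists>u v n. interior K = {u<..<v} \<and> K = {u..v} \<and> v - u = 1 / 2 ^ n" if K: "K \<in> \<D>" for K
    proof -
      obtain u v where uv: "K = cbox u v" using D(2)[OF K] by blast
      then obtain n where "v - u = 1 / 2 ^ n" using D(4)[of u v] K by auto
      then show ?thesis using uv by (auto simp: interior_atLeastAtMost_real)
    qed
    \<comment> \<open>The covering intervals overlap only in endpoints. Passing to interiors makes them disjoint and changes
      only a null set.\<close>
    define U where "U = (\<Union>K\<in>\<D>. interior K)"
    have UD: "U \<subseteq> \<Union>\<D>" unfolding U_def using interior_subset by blast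
    have null: "\<Union>\<D> - U \<in> null_sets lebesgue"
    proof -
      have "(\<Union>K\<in>\<D>. K - interior K) \<in> null_sets lebesgue"
      proof (rule null_sets_UN'[OF D(1)])
        fix K assume "K \<in> \<D>"
        then obtain u v n where uv: "interior K = {u<..<v}" "K = {u..v}" "v - u = 1 / 2 ^ n" using open_K by blast
        have "K - interior K \<subseteq> {u, v}" unfolding uv by auto
        then show "K - interior K \<in> null_sets lebesgue"
          by (meson finite.emptyI finite.insertI finite_subset negligible_finite negligible_iff_null_sets)
      qed
      moreover have "\<Union>\<D> - U \<subseteq> (\<Union>K\<in>\<D>. K - interior K)" by (auto simp: U_def)
      ultimately show ?thesis
        by (meson negligible_iff_null_sets negligible_subset)
    qed
    have disj: "disjoint_family_on interior \<D>"
      using D(3) by (auto simp: disjoint_family_on_def pairwise_def)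
    have disjB: "disjoint_family_on (\<lambda>K. B \<inter> interior K) \<D>"
      using disj by (auto simp: disjoint_family_on_def)
    have "ennreal \<beta> * emeasure lebesgue U = ennreal \<beta> * (\<integral>\<^sup>+K. emeasure lebesgue (interior K) \<partial>count_space \<D>)"
      unfolding U_def by (subst emeasure_UN_countable[OF _ D(1) disj]) auto
    also have "\<dots> = (\<integral>\<^sup>+K. ennreal \<beta> * emeasure lebesgue (interior K) \<partial>count_space \<D>)"
      by (simp add: nn_integral_cmult)
    also have "\<dots> \<le> (\<integral>\<^sup>+K. emeasure lebesgue (B \<inter> interior K) \<partial>count_space \<D>)"
    proof (rule nn_integral_mono)
      fix K assume "K \<in> space (count_space \<D>)"
      then have "K \<in> \<D>" by simp
      then obtain u v n where uv: "interior K = {u<..<v}" "v - u = 1 / 2 ^ n" using open_K by blast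
      show "ennreal \<beta> * emeasure lebesgue (interior K) \<le> emeasure lebesgue (B \<inter> interior K)"
        using emeasure_dyadic_interval_ge[OF B shiftB halfB uv(2)] fm
        by (simp add: uv(1) \<beta>_def emeasure_eq_measure2)
    qed
    also have "\<dots> = emeasure lebesgue (\<Union>K\<in>\<D>. B \<inter> interior K)"
      by (subst emeasure_UN_countable[OF _ D(1) disjB]) (use B in auto)
    also have "(\<Union>K\<in>\<D>. B \<inter> interior K) = B \<inter> U" by (auto simp: U_def)
    finally have dens: "ennreal \<beta> * emeasure lebesgue U \<le> emeasure lebesgue (B \<inter> U)" .
    have Uo: "open U" by (auto simp: U_def)
    have Um: "U \<in> lmeasurable"
    proof (rule lmeasurable_open[OF _ Uo])
      have "\<Union>\<D> \<subseteq> cbox 0 1" using D(2) by blast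
      then show "bounded U" using UD by (meson bounded_cbox bounded_subset)
    qed
    have BU: "B \<inter> U \<in> lmeasurable" using fmeasurable_Int_fmeasurable[OF Um B] by (simp add: Int_commute)
    have dens': "\<beta> * measure lebesgue U \<le> measure lebesgue (B \<inter> U)"
      using dens Um BU by (simp add: emeasure_eq_measure2 ennreal_mult[symmetric] \<beta>_def)
    have mU: "measure lebesgue U = measure lebesgue (\<Union>\<D>)"
    proof -
      have "measure lebesgue (\<Union>\<D>) = measure lebesgue (U \<union> (\<Union>\<D> - U))" using UD by (simp add: Un_absorb1)
      also have "\<dots> = measure lebesgue U"
        using null Um by (intro measure_Un_null_set) auto
      finally show ?thesis by simp
    qed
    have "B \<inter> U - S = B \<inter> U" by (auto simp: S_def B_def)
    then have "measure lebesgue S + measure lebesgue (B \<inter> U) = measure lebesgue (S \<union> (B \<inter> U))"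
      using measure_Un2[OF S BU] by simp
    also have "\<dots> \<le> measure lebesgue (\<Union>\<D>)"
      using D(5) UD by (intro measure_mono_fmeasurable D(6)) (use S BU in auto)
    finally have "\<beta> * measure lebesgue U \<le> e" using dens' D(7) by linarith
    moreover have "\<beta> * measure lebesgue S \<le> \<beta> * measure lebesgue U"
      unfolding mU using D(5) S D(6)
      by (intro mult_left_mono measure_mono_fmeasurable) (auto simp: \<beta>_def)
    ultimately show ?thesis by linarith
  qed
  have "\<beta> * measure lebesgue S \<le> 0"
  proof (rule field_le_epsilon)
    fix e :: real assume "0 < e"
    then show "\<beta> * measure lebesgue S \<le> 0 + e" using small[of e] by simp
  qed
  moreover have "measure lebesgue S > 0" "\<beta> \<ge> 0" using Sne by (auto simp: \<beta>_def zero_less_measure_iff)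
  ultimately have "\<beta> = 0" by (simp add: mult_le_0_iff)
  then have "B \<inter> {0<..1} \<in> null_sets lebesgue"
    using fm by (simp add: \<beta>_def negligible_iff_null_sets[symmetric] negligible_iff_measure)
  then have "B \<in> null_sets lebesgue" using null_of_unit[of B] shiftB by blast
  then show ?thesis by (rule AE_I'[of B]) (auto simp: B_def)
qed

text \<open>
  Allowing every constant \<open>C\<close> makes doubling map the set into itself, because
  \<open>dist_int (n * (2 * x)) \<le> 2 * dist_int (n * x)\<close>.
\<close>

lemma limsup_all_scalings_full:
  fixes \<Psi> :: "nat \<Rightarrow> real"
  assumes "\<not> (AE x in lebesgue. finite {n. n \<ge> 1 \<and> dist_int (real n * x) < \<Psi> n})"
  shows "AE x in lebesgue. \<exists>C::nat. infinite {n. n \<ge> 1 \<and> dist_int (real n * x) < real C * \<Psi> n}"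
proof -
  define E where "E = {x. \<exists>C::nat. infinite {n. n \<ge> 1 \<and> dist_int (real n * x) < real C * \<Psi> n}}"
  have "E = (\<Union>C::nat. \<Inter>m. \<Union>n\<in>{m..}. {x. n \<ge> 1 \<and> dist_int (real n * x) < real C * \<Psi> n})"
    unfolding E_def infinite_nat_iff_unbounded_le by (simp add: set_eq_iff Bex_def)
  also have "\<dots> \<in> sets borel" by measurable
  finally have E: "E \<in> sets lebesgue" by (simp add: sets_completionI_sets)
  have "AE x in lebesgue. x \<in> E"
  proof (rule zero_one_law_doubling[OF E])
    fix x assume "x \<in> E"
    then obtain C :: nat where C: "infinite {n. n \<ge> 1 \<and> dist_int (real n * x) < real C * \<Psi> n}"
      by (auto simp: E_def)
    have "{n. n \<ge> 1 \<and> dist_int (real n * x) < real C * \<Psi> n}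
       \<subseteq> {n. n \<ge> 1 \<and> dist_int (real n * (2 * x)) < real (2 * C) * \<Psi> n}"
    proof clarify
      fix n :: nat assume "dist_int (real n * x) < real C * \<Psi> n"
      moreover have "dist_int (real n * (2 * x)) \<le> 2 * dist_int (real n * x)"
        using dist_int_of_int_mult[of 2 "real n * x"] by (simp add: mult_ac)
      ultimately show "dist_int (real n * (2 * x)) < real (2 * C) * \<Psi> n" by simp
    qed
    then have "infinite {n. n \<ge> 1 \<and> dist_int (real n * (2 * x)) < real (2 * C) * \<Psi> n}"
      using C finite_subset by blast
    then show "2 * x \<in> E" unfolding E_def by blast
    fix z :: int
    have "dist_int (real n * (x + of_int z)) = dist_int (real n * x)" for n
      using dist_int_add_of_int[of "real n * x" "int n * z"] by (simp add: algebra_simps)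
    then show "x + of_int z \<in> E" unfolding E_def using C by auto
  next
    show "E \<notin> null_sets lebesgue"
    proof
      assume "E \<in> null_sets lebesgue"
      then have "AE x in lebesgue. x \<notin> E" by (rule AE_not_in)
      then have "AE x in lebesgue. finite {n. n \<ge> 1 \<and> dist_int (real n * x) < \<Psi> n}"
      proof eventually_elim
        case (elim x)
        then have "finite {n. n \<ge> 1 \<and> dist_int (real n * x) < real 1 * \<Psi> n}" unfolding E_def by blast
        then show ?case by simp
      qed
      then show False using assms by simp
    qed
  qed
  then show ?thesis by (simp add: E_def)
qed

section \<open>Divergent series and dyadic blocks\<close>

lemma filterlim_sum_at_top_of_not_summable:
  fixes f :: "nat \<Rightarrow> real"
  assumes nonneg: "\<And>n. f n \<ge> 0" and div: "\<not> summable f"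
  shows "filterlim (\<lambda>n. \<Sum>i<n. f i) at_top sequentially"
  unfolding filterlim_at_top eventually_sequentially
proof
  fix Z :: real
  have "\<exists>n. Z < (\<Sum>i<n. f i)"
  proof (rule ccontr)
    assume "\<nexists>n. Z < (\<Sum>i<n. f i)"
    then have "\<And>n. (\<Sum>i<n. f i) \<le> Z" by (simp add: not_less)
    then have "summable f" using nonneg by (intro summableI_nonneg_bounded[of f Z])
    then show False using div by simp
  qed
  then obtain n where n: "Z < (\<Sum>i<n. f i)" by blast
  have "(\<Sum>i<n. f i) \<le> (\<Sum>i<m. f i)" if "n \<le> m" for m
    using that nonneg by (intro sum_mono2) auto
  then show "\<exists>n. \<forall>m\<ge>n. Z \<le> (\<Sum>i<m. f i)" using n by (meson less_imp_le order.trans)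
qed

text \<open>
  Let \<open>s t\<close> be 1 plus the sum of the terms before index \<open>t\<close>. A block \<open>{p..<q}\<close> of the new series is at least
  \<open>(s q - s p) / s q\<close>. If the new series converged, this would be below \<open>1 / 2\<close> for fixed large \<open>p\<close> and all
  \<open>q\<close>, which forces \<open>s q \<le> 2 * s p\<close>.
\<close>

lemma abel_dini_divergence:
  fixes c :: "nat \<Rightarrow> real"
  assumes nonneg: "\<And>n. c n \<ge> 0" and div: "\<not> summable c"
  shows "\<not> summable (\<lambda>t. c t / (1 + (\<Sum>s\<le>t. c s)))"
proof
  define s where "s = (\<lambda>t. 1 + (\<Sum>i<t. c i))"
  define b where "b = (\<lambda>t. c t / (1 + (\<Sum>i\<le>t. c i)))"
  have s_mono: "s m \<le> s n" if "m \<le> n" for m n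
    unfolding s_def using that nonneg by (intro add_left_mono sum_mono2) auto
  have s1: "s n \<ge> 1" for n unfolding s_def using nonneg by (simp add: sum_nonneg)
  have b_eq: "b t = c t / s (Suc t)" for t by (simp add: b_def s_def lessThan_Suc_atMost)
  assume "summable (\<lambda>t. c t / (1 + (\<Sum>s\<le>t. c s)))"
  then have "summable b" by (simp add: b_def)
  then obtain p where p: "\<And>m n. m \<ge> p \<Longrightarrow> norm (sum b {m..<n}) < 1 / 2"
    unfolding summable_Cauchy by (metis half_gt_zero zero_less_one)
  have "s q \<le> 2 * s p" if q: "q \<ge> p" for q
  proof -
    have "(s q - s p) / s q = (\<Sum>t=p..<q. c t / s q)"
      using q by (simp add: s_def sum_divide_distrib[symmetric] sum_diff_nat_ivl lessThan_atLeast0)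
    also have "\<dots> \<le> sum b {p..<q}"
    proof (rule sum_mono)
      fix t assume "t \<in> {p..<q}"
      then show "c t / s q \<le> b t"
        unfolding b_eq using nonneg[of t] s1[of "Suc t"] by (intro divide_left_mono s_mono mult_pos_pos) (auto intro: less_le_trans[OF _ s1])
    qed
    also have "\<dots> \<le> 1 / 2" using p[of p q] by simp
    finally show ?thesis using s1[of q] by (simp add: field_simps)
  qed
  moreover have "s q \<le> 2 * s p" if "\<not> q \<ge> p" for q
    using s_mono[of q p] s1[of p] that by simp
  ultimately have "s q \<le> 2 * s p" for q by blast
  then have "(\<Sum>i<q. c i) \<le> 2 * s p" for q unfolding s_def by (smt (verit))
  then have "summable c" using nonneg by (intro summableI_nonneg_bounded[of c "2 * s p"])
  then show False using div by simp
qed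

lemma not_summable_min_one:
  fixes a :: "nat \<Rightarrow> real"
  assumes "\<And>n. a n \<ge> 0" "\<not> summable a"
  shows "\<not> summable (\<lambda>n. min (a n) 1)"
proof
  assume sm: "summable (\<lambda>n. min (a n) 1)"
  then have "(\<lambda>n. min (a n) 1) \<longlonglongrightarrow> 0" by (rule summable_LIMSEQ_zero)
  then have "\<forall>\<^sub>F n in sequentially. min (a n) 1 < 1" by (rule order_tendstoD) simp
  then have "\<forall>\<^sub>F n in sequentially. min (a n) 1 = a n" by eventually_elim auto
  then have "summable (\<lambda>n. min (a n) 1) = summable a" by (rule summable_cong)
  then have "summable a" using sm by simp
  then show False using assms by simp
qed

lemma sum_dyadic_blocks:
  fixes f :: "nat \<Rightarrow> real"
  shows "(\<Sum>n=1..2^T. f n) = f 1 + (\<Sum>t<T. \<Sum>n\<in>{2^t<..2^(t+1)}. f n)"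
proof (induction T)
  case (Suc T)
  have "{1..2^Suc T} = {1..2^T} \<union> {2^T<..2^(T+1)::nat}" by auto
  moreover have "{1..2^T} \<inter> {2^T<..2^(T+1)::nat} = {}" by auto
  ultimately show ?case using Suc by (simp add: sum.union_disjoint)
qed auto

text \<open>
  Cauchy condensation. The block after \<open>2 ^ (t + 1)\<close> is compared with the value at \<open>2 ^ (t + 1)\<close>, and
  \<open>ln n \<le> t + 2 \<le> 3 * L * (t div L)\<close> there for \<open>t \<ge> L\<close>, so that rounding \<open>t / L\<close> down costs only a constant.
\<close>

lemma condensation_not_summable:
  fixes \<psi> :: "nat \<Rightarrow> real"
  assumes L: "L \<ge> 1"
    and nonneg: "\<And>n. n \<ge> 1 \<Longrightarrow> \<psi> n \<ge> 0"
    and dec: "\<And>m n. 1 \<le> m \<Longrightarrow> m \<le> n \<Longrightarrow> \<psi> n \<le> \<psi> m"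
    and div: "filterlim (\<lambda>N. \<Sum>n=1..N. \<psi> n * ln (real n) ^ d) at_top sequentially"
  shows "\<not> summable (\<lambda>t. 2 ^ t * real (t div L) ^ d * \<psi> (2 ^ (t + 1)))"
proof
  let ?a = "\<lambda>t. 2 ^ t * real (t div L) ^ d * \<psi> (2 ^ (t + 1))"
  let ?g = "\<lambda>n. \<psi> n * ln (real n) ^ d"
  define B where "B = (\<lambda>t. \<Sum>n\<in>{2^t<..2^(t+1)}. ?g n)"
  assume sm: "summable ?a"
  have B_le: "B (Suc t) \<le> 2 * (3 * real L) ^ d * ?a t" if t: "t \<ge> L" for t
  proof -
    have tdiv: "t div L \<ge> 1" using t L by (simp add: less_eq_div_iff_mult_less_eq)
    have "t < L * (t div L + 1)" using dividend_less_times_div[of L t] L by simp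
    then have "t + 1 \<le> L * (t div L) + L" by simp
    moreover have "L * 1 \<le> L * (t div L)" using tdiv by (intro mult_left_mono) auto
    ultimately have "t + 2 \<le> 3 * (L * (t div L))" using L by linarith
    then have "t + 2 \<le> 3 * L * (t div L)" by (simp only: mult.assoc)
    then have t2: "real t + 2 \<le> 3 * real L * real (t div L)"
      by (metis of_nat_add of_nat_le_iff of_nat_mult of_nat_numeral)
    have "B (Suc t) \<le> (\<Sum>n\<in>{2^Suc t<..2^(Suc t+1)::nat}. \<psi> (2 ^ (t+1)) * (3 * real L * real (t div L)) ^ d)"
      unfolding B_def
    proof (rule sum_mono)
      fix n :: nat assume n: "n \<in> {2^Suc t<..2^(Suc t+1)}"
      have n1: "1 \<le> n" "2 ^ (t+1) \<le> n" using n by auto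
      have "ln (real n) \<le> ln (2 ^ (t + 2))"
      proof -
        have "real n \<le> real (2 ^ (t+2))" using n by (simp only: of_nat_le_iff) simp
        then show ?thesis using n1 by simp
      qed
      also have "\<dots> = real (t + 2) * ln 2" by (rule ln_realpow)
      also have "\<dots> = (real t + 2) * ln 2" by simp
      also have "\<dots> \<le> (real t + 2) * 1" using ln_2_less_1 by (intro mult_left_mono) auto
      also have "\<dots> \<le> 3 * real L * real (t div L)" using t2 by simp
      finally have "ln (real n) \<le> 3 * real L * real (t div L)" .
      then have "ln (real n) ^ d \<le> (3 * real L * real (t div L)) ^ d"
        using n1 by (intro power_mono) auto
      then show "?g n \<le> \<psi> (2 ^ (t+1)) * (3 * real L * real (t div L)) ^ d"
        using n1 by (intro mult_mono dec nonneg) auto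
    qed
    also have "\<dots> = 2 ^ Suc t * (\<psi> (2 ^ (t+1)) * (3 * real L * real (t div L)) ^ d)" by simp
    also have "\<dots> = 2 * (3 * real L) ^ d * ?a t" by (simp add: power_mult_distrib)
    finally show ?thesis .
  qed
  have B0: "B t \<ge> 0" for t unfolding B_def
  proof (intro sum_nonneg mult_nonneg_nonneg nonneg zero_le_power)
    fix n assume "n \<in> {2^t<..2^(t+1)::nat}"
    then have "1 \<le> n" by auto
    then show "1 \<le> n" "0 \<le> ln (real n)" by auto
  qed
  have "summable (\<lambda>t. B (Suc t))"
  proof (rule summable_comparison_test_ev)
    show "\<forall>\<^sub>F t in sequentially. norm (B (Suc t)) \<le> 2 * (3 * real L) ^ d * ?a t"
      using eventually_ge_at_top[of L] by eventually_elim (use B_le B0 in auto)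
    show "summable (\<lambda>t. 2 * (3 * real L) ^ d * ?a t)" using sm by (rule summable_mult)
  qed
  then have "summable B" by (simp add: summable_Suc_iff)
  then have bound: "(\<Sum>t<T. B t) \<le> suminf B" for T by (rule sum_le_suminf) (use B0 in auto)
  have "\<forall>\<^sub>F N in sequentially. ?g 1 + suminf B + 1 \<le> (\<Sum>n=1..N. ?g n)"
    using div unfolding filterlim_at_top by blast
  then obtain N0 where N0: "\<And>N. N \<ge> N0 \<Longrightarrow> ?g 1 + suminf B + 1 \<le> (\<Sum>n=1..N. ?g n)"
    by (auto simp: eventually_sequentially)
  have "N0 \<le> 2 ^ N0" by (rule less_imp_le) (rule less_exp)
  from N0[OF this] bound[of N0] show False unfolding sum_dyadic_blocks B_def by simp
qed

text \<open>
  The index \<open>t\<close> with \<open>2 ^ t < n \<le> 2 ^ (t + 1)\<close> when \<open>n \<ge> 2\<close>. The values \<open>n = 0\<close> and \<open>n = 1\<close>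
  receive index 0, which does not describe them; the approximation function below vanishes on index 0.
\<close>

definition dyadic_block :: "nat \<Rightarrow> nat" where
  "dyadic_block n = (LEAST t. n \<le> 2 ^ (t + 1))"

lemma dyadic_block_eq: "n \<in> {2^t<..2^(t+1)} \<Longrightarrow> dyadic_block n = t"
  unfolding dyadic_block_def
proof (rule Least_equality)
  fix s assume n: "n \<in> {2^t<..2^(t+1)}" "n \<le> 2 ^ (s + 1)"
  then have "(2::nat) ^ t < 2 ^ (s + 1)" by auto
  then have "t < s + 1" by (rule power_less_imp_less_exp[rotated]) simp
  then show "t \<le> s" by simp
qed auto

lemma le_power_dyadic_block: "n \<le> 2 ^ (dyadic_block n + 1)"
proof -
  have "n \<le> 2 ^ (n + 1)" by (rule less_imp_le, rule less_trans[OF less_exp]) simp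
  then show ?thesis unfolding dyadic_block_def by (rule LeastI)
qed

lemma mem_dyadic_block:
  assumes "dyadic_block n \<ge> 1" shows "n \<in> {2^dyadic_block n<..2^(dyadic_block n + 1)}"
proof -
  have "\<not> n \<le> 2 ^ ((dyadic_block n - 1) + 1)"
    using assms not_less_Least[of "dyadic_block n - 1" "\<lambda>t. n \<le> 2 ^ (t + 1)"] unfolding dyadic_block_def by simp
  then show ?thesis using assms le_power_dyadic_block[of n] by simp
qed

text \<open>
  Here \<open>b t\<close> is, up to constants, the mass that \<open>\<Psi>\<close> has on block \<open>t\<close>, both with and without the density of
  reduced residues.
\<close>

lemma dyadic_approximation_function:
  fixes W :: "nat \<Rightarrow> nat \<Rightarrow> real" and v b :: "nat \<Rightarrow> real"
  defines "\<Psi> \<equiv> \<lambda>n. v (dyadic_block n) * W (dyadic_block n) n"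
  assumes W0: "\<And>t n. W t n \<ge> 0" and v0: "\<And>t. v t \<ge> 0"
    and start: "r \<ge> 1" "\<And>t. t < r \<Longrightarrow> v t = 0 \<and> b t = 0"
    and small: "\<And>t n. t \<ge> r \<Longrightarrow> v t * W t n \<le> 1"
    and upper: "\<And>t. t \<ge> r \<Longrightarrow> v t * (\<Sum>n\<in>{2^t<..2^(t+1)}. W t n) \<le> 2 * b t"
    and lower: "\<And>t. t \<ge> r \<Longrightarrow> b t / 8 \<le> v t * (\<Sum>n\<in>{2^t<..2^(t+1)}. W t n * real (card (totatives n)) / real n)"
    and b0: "\<And>t. b t \<ge> 0" and div: "\<not> summable b"
  shows "\<not> (AE x in lebesgue. finite {n. n \<ge> 1 \<and> dist_int (real n * x) < \<Psi> n})"
proof (rule limsup_reduced_intervals_not_null[where N = "\<lambda>T. 2 ^ T" and S = "\<lambda>T. \<Sum>t<T. b t" and c = "1 / 8" and C = 2])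
  show nonneg: "\<Psi> n \<ge> 0" for n using W0 v0 by (simp add: \<Psi>_def)
  show "\<Psi> n \<le> real n" if "n \<ge> 1" for n
  proof (cases "dyadic_block n \<ge> r")
    case True
    have "\<Psi> n \<le> 1" unfolding \<Psi>_def by (rule small[OF True])
    then show ?thesis using that by simp
  qed (use start(2) in \<open>simp add: \<Psi>_def\<close>)
  have one: "\<Psi> 1 = 0"
  proof -
    have "dyadic_block 1 = 0" unfolding dyadic_block_def by (rule Least_equality) auto
    then show ?thesis using start by (simp add: \<Psi>_def)
  qed
  have block: "(\<Sum>n\<in>{2^t<..2^(t+1)}. \<Psi> n * f n) = v t * (\<Sum>n\<in>{2^t<..2^(t+1)}. W t n * f n)" for t and f :: "nat \<Rightarrow> real"
    unfolding sum_distrib_left by (intro sum.cong refl) (simp add: \<Psi>_def dyadic_block_eq)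
  show "1 / 8 * (\<Sum>t<T. b t) \<le> (\<Sum>n=1..2^T. \<Psi> n * real (card (totatives n)) / real n)" for T
  proof -
    have "1 / 8 * (\<Sum>t<T. b t) = (\<Sum>t<T. b t / 8)" by (simp add: sum_divide_distrib)
    also have "\<dots> \<le> (\<Sum>t<T. \<Sum>n\<in>{2^t<..2^(t+1)}. \<Psi> n * (real (card (totatives n)) / real n))"
    proof (rule sum_mono)
      fix t
      show "b t / 8 \<le> (\<Sum>n\<in>{2^t<..2^(t+1)}. \<Psi> n * (real (card (totatives n)) / real n))"
        unfolding block using lower[of t] start(2)[of t] by (cases "t \<ge> r") auto
    qed
    finally show ?thesis unfolding sum_dyadic_blocks one by simp
  qed
  show "(\<Sum>n=1..2^T. \<Psi> n) \<le> 2 * (\<Sum>t<T. b t)" for T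
  proof -
    have "(\<Sum>n\<in>{2^t<..2^(t+1)}. \<Psi> n) \<le> 2 * b t" for t
      using block[where t = t and f = "\<lambda>_. 1"] upper[of t] start(2)[of t] by (cases "t \<ge> r") auto
    then have "(\<Sum>t<T. \<Sum>n\<in>{2^t<..2^(t+1)}. \<Psi> n) \<le> (\<Sum>t<T. 2 * b t)" by (intro sum_mono)
    then show ?thesis unfolding sum_dyadic_blocks one by (simp add: sum_distrib_left)
  qed
  show "filterlim (\<lambda>T. \<Sum>t<T. b t) at_top sequentially"
    by (rule filterlim_sum_at_top_of_not_summable[OF b0 div])
qed auto

section \<open>The multiplicative approximation theorem\<close>

theorem theorem1p2:
  fixes k :: nat and \<alpha> \<gamma> :: "nat \<Rightarrow> real" and \<psi> :: "nat \<Rightarrow> real"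
  assumes "k \<ge> 2"
    and "mult_exponent (k - 1) \<alpha> <
          (if k = 2 then \<infinity> else ereal ((real k - 1) / (real k - 2)))"
    and "\<And>n. n \<ge> 1 \<Longrightarrow> \<psi> n \<ge> 0"
    and "\<And>n. n \<ge> 1 \<Longrightarrow> \<psi> n \<ge> \<psi> (n + 1)"
    and "filterlim (\<lambda>N. \<Sum>n=1..N. \<psi> n * ln (real n) ^ (k - 1)) at_top sequentially"
  shows "AE a in lebesgue. infinite {n :: nat. n \<ge> 1 \<and>
          (\<Prod>i=1..k-1. dist_int (real n * \<alpha> i - \<gamma> i)) * dist_int (real n * a) < \<psi> n}"
proof -
  define d where "d = k - 1"
  have d: "d \<ge> 1" "real d = real k - 1" using assms(1) by (auto simp: d_def of_nat_diff)
  have k: "(k = 2) = (d = 1)" "real k - 1 = real d" "real k - 2 = real d - 1"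
    using d assms(1) by (auto simp: d_def)
  have "mult_exponent d \<alpha> < (if d = 1 then \<infinity> else ereal (real d / (real d - 1)))"
    using assms(2) unfolding k d_def[symmetric] .
  from linear_form_lower_bound[OF d(1) this] obtain B \<tau> :: nat where B: "B \<ge> 1"
    and lb: "\<And>H h. \<lbrakk>\<And>i. i \<in> {1..d} \<Longrightarrow> \<bar>h i\<bar> \<le> int H; \<exists>i\<in>{1..d}. h i \<noteq> 0\<rbrakk>
       \<Longrightarrow> 1 \<le> real B * real H ^ \<tau> * dist_int (\<Sum>i=1..d. of_int (h i) * \<alpha> i)"
    by blast
  have dec: "\<psi> n \<le> \<psi> m" if "1 \<le> m" "m \<le> n" for m n
    using that(2)
  proof (induction n rule: dec_induct)
    case (step n)
    then have "\<psi> (n + 1) \<le> \<psi> n" using that(1) by (intro assms(4)) simp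
    then show ?case using step.IH by simp
  qed simp
  \<comment> \<open>The degree \<open>2 ^ J t\<close> of the weights on block \<open>t\<close> is at most the \<open>L\<close>-th root of \<open>2 ^ t\<close>.\<close>
  define L where "L = d + 2 * \<tau> + 2"
  define J where "J = (\<lambda>t. t div L)"
  define W where "W = (\<lambda>t. bohr_weight d \<alpha> \<gamma> (J t))"
  have W0: "W t n \<ge> 0" for t n unfolding W_def by (rule bohr_weight_nonneg)
  have "\<forall>\<^sub>F j in sequentially. r * (real j + 1) \<le> 2 ^ j" for r :: real by real_asymp
  then have "\<forall>\<^sub>F j in sequentially. 64 * real L * (real j + 1) \<le> 2 ^ j" .
  moreover have "\<forall>\<^sub>F j in sequentially. r \<le> 2 ^ j" for r :: real by real_asymp
  then have "\<forall>\<^sub>F j in sequentially. 2 ^ (d + 6) * real B \<le> 2 ^ j" .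
  ultimately have "\<forall>\<^sub>F j in sequentially. 64 * real L * (real j + 1) \<le> 2 ^ j \<and> 2 ^ (d + 6) * real B \<le> 2 ^ j"
    by (rule eventually_conj)
  then obtain j0 where j0: "\<And>j. j \<ge> j0 \<Longrightarrow> 64 * real L * (real j + 1) \<le> 2 ^ j \<and> 2 ^ (d + 6) * real B \<le> 2 ^ j"
    unfolding eventually_sequentially by blast
  define t0 where "t0 = L * (j0 + 1)"
  have t0: "t0 \<ge> 1" by (simp add: t0_def L_def)
  have Jt: "J t \<ge> 1" "J t \<ge> j0" if "t \<ge> t0" for t
  proof -
    have "t0 div L \<le> t div L" using that by (rule div_le_mono)
    moreover have "t0 div L = j0 + 1"
      unfolding t0_def by (rule nonzero_mult_div_cancel_left) (simp add: L_def)
    ultimately show "J t \<ge> 1" "J t \<ge> j0" by (simp_all add: J_def)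
  qed
  define X where "X = (\<lambda>t. 2 ^ t * real (J t) ^ d)"
  have est: "(\<Sum>n\<in>{2^t<..2^(t+1)}. W t n) \<le> 2 * X t"
      "(\<Sum>n\<in>{2^t<..2^(t+1)}. W t n * real (card (totatives n)) / real n) \<ge> X t / 8"
      "W t n \<le> 2 ^ t" if t: "t \<ge> t0" for t n
  proof -
    have p: "J t \<ge> 1" "64 * real L * (real (J t) + 1) \<le> 2 ^ J t" "2 ^ (d + 6) * real B \<le> 2 ^ J t"
      using Jt[OF t] j0[of "J t"] by auto
    have Jt_eq: "J t = t div L" by (simp add: J_def)
    note est_t = bohr_weight_block_estimates[OF lb B p L_def Jt_eq]
    show "(\<Sum>n\<in>{2^t<..2^(t+1)}. W t n) \<le> 2 * X t"
      unfolding W_def X_def by (rule est_t(1))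
    show "(\<Sum>n\<in>{2^t<..2^(t+1)}. W t n * real (card (totatives n)) / real n) \<ge> X t / 8"
      unfolding W_def X_def by (rule est_t(2))
    show "W t n \<le> 2 ^ t" unfolding W_def using bohr_weight_le est_t(3) order.trans by blast
  qed
  \<comment> \<open>The natural mass of block \<open>t\<close> is \<open>a t\<close>. It is truncated to \<open>c t \<le> 1\<close>, which keeps \<open>\<Psi>\<close> below 1, and divided by
    \<open>s t\<close>, which tends to infinity and will absorb the constant \<open>C\<close>. Blocks before \<open>t0\<close> are dropped, as the
    estimates hold only from there on.\<close>
  define a where "a = (\<lambda>t. X t * \<psi> (2 ^ (t + 1)))"
  define c where "c = (\<lambda>t. if t \<ge> t0 then min (a t) 1 else 0)"
  define s where "s = (\<lambda>t. 1 + (\<Sum>i\<le>t. c i))"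
  define b where "b = (\<lambda>t. c t / s t)"
  define v where "v = (\<lambda>t. b t / X t)"
  have X0: "X t \<ge> 0" for t by (simp add: X_def)
  have X1: "X t \<ge> 2 ^ t" if "t \<ge> t0" for t using Jt(1)[OF that] by (simp add: X_def)
  have a0: "a t \<ge> 0" for t using assms(3)[of "2 ^ (t+1)"] X0[of t] by (simp add: a_def)
  have c0: "c t \<ge> 0" for t using a0 by (simp add: c_def)
  have s1: "s t \<ge> 1" for t using c0 by (simp add: s_def sum_nonneg)
  have b0: "b t \<ge> 0" for t using c0[of t] s1[of t] by (simp add: b_def)
  have b1: "b t \<le> 1" for t
  proof -
    have "c t \<le> s t" using s1[of t] by (auto simp: c_def min_def)
    then show ?thesis using s1[of t] by (simp add: b_def)
  qed
  have v0: "v t \<ge> 0" for t using b0 X0 by (simp add: v_def)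
  have "\<not> summable a"
    unfolding a_def X_def J_def
    by (rule condensation_not_summable[OF _ assms(3) dec]) (use assms(5) in \<open>auto simp: L_def d_def\<close>)
  then have "\<not> summable (\<lambda>t. min (a t) 1)" using not_summable_min_one a0 by blast
  moreover have "\<forall>\<^sub>F t in sequentially. min (a t) 1 = c t"
    using eventually_ge_at_top[of t0] by eventually_elim (simp add: c_def)
  then have "summable (\<lambda>t. min (a t) 1) = summable c" by (rule summable_cong)
  ultimately have divc: "\<not> summable c" by simp
  then have divb: "\<not> summable b" unfolding b_def s_def using c0 by (rule abel_dini_divergence[rotated])
  define \<Psi> where "\<Psi> = (\<lambda>n. v (dyadic_block n) * W (dyadic_block n) n)"
  have "\<not> (AE x in lebesgue. finite {n. n \<ge> 1 \<and> dist_int (real n * x) < \<Psi> n})"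
    unfolding \<Psi>_def
  proof (rule dyadic_approximation_function[where r = t0 and b = b])
    show "v t = 0 \<and> b t = 0" if "t < t0" for t using that by (simp add: v_def b_def c_def)
    fix t assume t: "t \<ge> t0"
    have Xpos: "X t > 0" using X1[OF t] by (rule less_le_trans[rotated]) simp
    have vX: "v t * X t = b t" using Xpos by (simp add: v_def)
    show "v t * (\<Sum>n\<in>{2^t<..2^(t+1)}. W t n) \<le> 2 * b t"
      using mult_left_mono[OF est(1)[OF t] v0[of t]] vX by simp
    show "b t / 8 \<le> v t * (\<Sum>n\<in>{2^t<..2^(t+1)}. W t n * real (card (totatives n)) / real n)"
      using mult_left_mono[OF est(2)[OF t] v0[of t]] vX by simp
    fix n
    have "v t * W t n \<le> v t * X t"
      using est(3)[OF t, of n] X1[OF t] v0[of t] by (intro mult_left_mono) auto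
    then show "v t * W t n \<le> 1" using b1[of t] vX by simp
  qed (use W0 v0 t0 b0 divb in auto)
  then have "AE x in lebesgue. \<exists>C::nat. infinite {n. n \<ge> 1 \<and> dist_int (real n * x) < real C * \<Psi> n}"
    by (rule limsup_all_scalings_full)
  then show ?thesis
    unfolding d_def[symmetric]
  proof eventually_elim
    case (elim x)
    then obtain C :: nat where C: "infinite {n. n \<ge> 1 \<and> dist_int (real n * x) < real C * \<Psi> n}" by blast
    have "filterlim (\<lambda>T. \<Sum>t<T. c t) at_top sequentially"
      by (rule filterlim_sum_at_top_of_not_summable[OF c0 divc])
    then have "\<forall>\<^sub>F T in sequentially. real C * 3 ^ d \<le> (\<Sum>t<T. c t)" unfolding filterlim_at_top by blast
    then obtain t1 where t1: "\<And>T. T \<ge> t1 \<Longrightarrow> real C * 3 ^ d \<le> (\<Sum>t<T. c t)"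
      by (auto simp: eventually_sequentially)
    have s_ge: "real C * 3 ^ d \<le> s t" if "t \<ge> t1" for t
      using t1[of "Suc t"] that by (simp add: s_def lessThan_Suc_atMost)
    let ?G = "{n. n \<ge> 1 \<and> dist_int (real n * x) < real C * \<Psi> n}"
    let ?R = "{n. n \<ge> 1 \<and> (\<Prod>i=1..d. dist_int (real n * \<alpha> i - \<gamma> i)) * dist_int (real n * x) < \<psi> n}"
    have "?G - {..2 ^ (t1 + 1)} \<subseteq> ?R"
    proof
      fix n assume n: "n \<in> ?G - {..2 ^ (t1 + 1)}"
      define t where "t = dyadic_block n"
      let ?P = "\<Prod>i=1..d. dist_int (real n * \<alpha> i - \<gamma> i)"
      have n1: "n \<ge> 1" and dn: "dist_int (real n * x) < real C * (v t * W t n)"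
        using n by (auto simp: \<Psi>_def t_def)
      have "0 < real C * (v t * W t n)" using dn dist_int_nonneg[of "real n * x"] by linarith
      then have vpos: "v t \<noteq> 0" and Cpos: "real C > 0" by (auto intro: Nat.gr0I)
      have tt0: "t \<ge> t0"
        using vpos by (rule contrapos_np) (simp add: v_def b_def c_def)
      have "2 ^ (t1 + 1) < n" using n by auto
      also have "n \<le> 2 ^ (t + 1)" unfolding t_def by (rule le_power_dyadic_block)
      finally have "2 ^ (t1 + 1) < (2::nat) ^ (t + 1)" .
      then have tt1: "t \<ge> t1" using power_less_imp_less_exp[of "2::nat" "t1 + 1" "t + 1"] by simp
      have blk: "n \<in> {2^t<..2^(t+1)}" using mem_dyadic_block[of n] tt0 t0 by (simp add: t_def)
      have Xpos: "X t > 0" using X1[OF tt0] by (rule less_le_trans[rotated]) simp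
      have vpos': "v t > 0" using vpos v0[of t] by simp
      have "real C * 3 ^ d * v t \<le> s t * v t" using s_ge[OF tt1] v0 by (intro mult_right_mono)
      also have "\<dots> = c t / X t" using s1[of t] by (simp add: v_def b_def)
      also have "\<dots> \<le> a t / X t" using Xpos tt0 by (intro divide_right_mono) (auto simp: c_def)
      also have "\<dots> = \<psi> (2 ^ (t+1))" using Xpos by (simp add: a_def)
      also have "\<dots> \<le> \<psi> n" using blk n1 by (intro dec) auto
      finally have key: "real C * 3 ^ d * v t \<le> \<psi> n" .
      have P0: "?P \<ge> 0" by (intro prod_nonneg) auto
      have "?P * dist_int (real n * x) < \<psi> n"
      proof (cases "?P = 0")
        case True
        have "0 < real C * 3 ^ d * v t" using Cpos vpos' by simp
        then have "0 < \<psi> n" using key by (rule less_le_trans)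
        then show ?thesis unfolding True by simp
      next
        case False
        then have "?P > 0" using P0 by (simp only: order_less_le not_False_eq_True simp_thms eq_commute[of 0])
        then have "?P * dist_int (real n * x) < ?P * (real C * (v t * W t n))"
          by (rule mult_strict_left_mono[OF dn])
        also have "\<dots> = real C * v t * (W t n * ?P)" by simp
        also have "\<dots> \<le> real C * v t * 3 ^ d"
          unfolding W_def using Cpos vpos' by (intro mult_left_mono bohr_weight_mult_prod_le) auto
        also have "\<dots> \<le> \<psi> n" using key by (simp add: mult_ac)
        finally show ?thesis .
      qed
      then show "n \<in> ?R" using n1 by blast
    qed
    moreover have "infinite (?G - {..2 ^ (t1 + 1)})" using C by simp
    ultimately show ?case using finite_subset by blast
  qed
qed

end
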